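(* Let the semicocycle $\psi$ in $\mathbb{E}$ over $(\mathcal{Q},\vartheta)$ satisfy, with respect to one family of quadratic forms $V_q$ as described in the context, the negative squeezing property, the positive squeezing property, the uniform Lipschitz property and the bounded projectors property. Let $\mathcal{M}$ be a $\varkappa$-admissible set over $q\in\mathcal{Q}$ for some $\varkappa\in(0,1)$. Then for every $v_0\in\mathbb{E}$ there exists a unique $v_0^*\in\mathcal{M}$ such that $v_0^*\in[v_0]^+(q)$. Moreover, there exists a function $R\colon\mathbb{R}_+^3\to\mathbb{R}_+$ (not depending on $q$, $\mathcal{M}$, $\varkappa$, $v_0$), non-decreasing in each variable, such that if $\mathcal{M}$ is $L(\mathcal{M})$-Lipschitz $\varkappa$-admissible over $q$, then $$\|\psi^t(q,v_0)-\psi^t(q,v_0^* )\|_{\mathbb{E}}\le R\left(C_q^{-1},(1-\varkappa)^{-1},L(\mathcal{M})\right)\operatorname{dist}(v_0,\mathcal{M})\,e^{-\beta(t;q)}\quad\text{for all }t\ge0.$$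
   Context: Setting. $\mathbb{R}_+=[0,\infty)$; $\mathcal{Q}$ is a complete metric space; $\vartheta=\{\vartheta^t\}_{t\ge 0}$ is a semiflow on $\mathcal{Q}$ ($\vartheta^0=\mathrm{id}$, $\vartheta^{t+s}=\vartheta^t\circ\vartheta^s$, jointly continuous in $(t,q)$); $\mathbb{E}$ is a real or complex Banach space continuously embedded in a Hilbert space $\mathbb{H}$ with norm $|\cdot|_{\mathbb{H}}$. A semicocycle $\psi$ in $\mathbb{E}$ over $(\mathcal{Q},\vartheta)$ is a family of maps $\psi^t(q,\cdot)\colon\mathbb{E}\to\mathbb{E}$, $t\ge0$, $q\in\mathcal{Q}$, with $\psi^0(q,v)=v$, $\psi^{t+s}(q,v)=\psi^t(\vartheta^s(q),\psi^s(q,v))$ and $(t,q,v)\mapsto\psi^t(q,v)$ continuous. Quadratic forms. $\langle v,f\rangle$ is the pairing of $v\in\mathbb{E}$, $f\in\mathbb{E}^*$ (in the complex case $\mathbb{E}^*$ consists of conjugate-linear functionals). For each $q\in\mathcal{Q}$ there are an operator $Q(q)\in\mathcal{L}(\mathbb{E};\mathbb{E}^* )$, symmetric ($\langle v_1,Q(q)v_2\rangle=\overline{\langle v_2,Q(q)v_1\rangle}$), and a direct sum splitting of $\mathbb{E}$ into a closed subspace and a subspace $\mathbb{E}^-(q)$ of dimension $j$ (a fixed integer $j\ge0$) such that $V_q(v):=\langle v,Q(q)v\rangle$ is positive for nonzero $v$ in the former and negative for nonzero $v\in\mathbb{E}^-(q)$; moreover $\sup_q\|Q(q)\|<\infty$.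 The $V_q$-orthogonal projector $\Pi_q\colon\mathbb{E}\to\mathbb{E}^-(q)$ is the bounded projector determined by $\langle w,Q(q)v\rangle=\langle w,Q(q)\Pi_qv\rangle$ for all $w\in\mathbb{E}^-(q)$, $v\in\mathbb{E}$. Put $\Pi^+_q=I-\Pi_q$, $\mathbb{E}^+(q)=\operatorname{Ker}\Pi_q$; then $V_q(v)=V_q(\Pi_qv)+V_q(\Pi_q^+v)$. For $\varkappa\in(0,1]$ put $V_q^{(\varkappa)}(v)=V_q(\Pi_q^+v)+\varkappa^2V_q(\Pi_qv)$. Put $C_q:=\inf\{(-V_q(\zeta))^{1/2}:\zeta\in\mathbb{E}^-(q),\|\zeta\|_{\mathbb{E}}=1\}$. Negative squeezing property: there are constants $-\infty<\alpha^-<\alpha^+<\infty$, $\delta_Q>0$, $\tau_Q\ge0$ and a Borel function $\alpha_0\colon\mathcal{Q}\to[\alpha^-,\alpha^+]$ such that, with $\alpha(t;q)=\int_0^t\alpha_0(\vartheta^s(q))ds$, $$e^{2\alpha(r;q)}V_{\vartheta^r(q)}(\psi^r(q,v_1)-\psi^r(q,v_2))-V_q(v_1-v_2)\le-\delta_Q\int_0^re^{2\alpha(s;q)}|\psi^s(q,v_1)-\psi^s(q,v_2)|^2_{\mathbb{H}}ds$$ for all $q\in\mathcal{Q}$, $r\ge\tau_Q$ and $v_1,v_2\in\mathbb{E}$ with $V_q(v_1-v_2)\le0$. Positive squeezing property: for the same operators, spaces, $\delta_Q$ and $\tau_Q$, there are constants $-\infty<\beta^-<\beta^+<\infty$ and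 a Borel function $\beta_0\colon\mathcal{Q}\to[\beta^-,\beta^+]$ such that, with $\beta(t;q)=\int_0^t\beta_0(\vartheta^s(q))ds$, $$e^{2\beta(r;q)}V_{\vartheta^r(q)}(\psi^r(q,v_1)-\psi^r(q,v_2))-V_q(v_1-v_2)\le-\delta_Q\int_0^re^{2\beta(s;q)}|\psi^s(q,v_1)-\psi^s(q,v_2)|^2_{\mathbb{H}}ds$$ for all $q\in\mathcal{Q}$, $r\ge\tau_Q$ and $v_1,v_2\in\mathbb{E}$ with $V_{\vartheta^r(q)}(\psi^r(q,v_1)-\psi^r(q,v_2))\ge0$. Uniform Lipschitz property: there is $\tau_S\ge0$ such that for every $T>0$ there is $L_T>0$ with $\|\psi^t(q,v_1)-\psi^t(q,v_2)\|_{\mathbb{E}}\le L_T|v_1-v_2|_{\mathbb{H}}$ for $t\in[\tau_S,\tau_S+T]$ and $\|\psi^t(q,v_1)-\psi^t(q,v_2)\|_{\mathbb{E}}\le L_T\|v_1-v_2\|_{\mathbb{E}}$ for $t\in[0,T]$, for all $q,v_1,v_2$. Bounded projectors property: $\sup_{q}\|\Pi_q\|<\infty$. Positive equivalence: $v_1,v_2\in\mathbb{E}$ are positively equivalent over $q$ if $V_{\vartheta^t(q)}(\psi^t(q,v_1)-\psi^t(q,v_2))\ge0$ for all $t\ge0$; $[v_0]^+(q)$ is the set of all $v\in\mathbb{E}$ positively equivalent to $v_0$ over $q$. Admissible sets. For $\varkappa\in(0,1)$, $\mathcal{M}\subset\mathbb{E}$ is $\varkappa$-admissible over $q$ if $V_q^{(\varkappa)}(v_1-v_2)\le0$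 for all $v_1,v_2\in\mathcal{M}$ and $\Pi_q\colon\mathcal{M}\to\mathbb{E}^-(q)$ is a homeomorphism. It is $L(\mathcal{M})$-Lipschitz $\varkappa$-admissible if in addition the inverse of $\Pi_q\colon\mathcal{M}\to\mathbb{E}^-(q)$ is Lipschitz with constant $L(\mathcal{M})$.
   Formalization: Uniqueness of v_0^* is claimed only when α(t;q)−β(t;q) does not tend to +∞ as t→∞ (e.g. when α_0≤β_0); with unrelated rates uniqueness can fail. Existence and the exponential estimate (for every point of M in [v_0]^+(q)) need no such condition. *)

theory Defs
  imports "HOL-Analysis.Analysis"
begin

(* Scalars. "Real or complex" is a type class with the two instances real and complex.
   By Gelfand-Mazur a normed field over the reals with multiplicative norm is isometrically
   the real or the complex field, and the first axiom then forces sconj to be the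
   conjugation, so the class has no further models. *)
class real_or_complex = real_normed_field +
  fixes sconj :: "'a \<Rightarrow> 'a" and sre :: "'a \<Rightarrow> real"
  assumes mult_sconj: "x * sconj x = (norm x)\<^sup>2 *\<^sub>R 1"
    and sre_eq: "sre x *\<^sub>R 1 = (x + sconj x) / 2"

instantiation real :: real_or_complex
begin
definition sconj_real :: "real \<Rightarrow> real" where "sconj_real x = x"
definition sre_real :: "real \<Rightarrow> real" where "sre_real x = x"
instance
  by standard (simp_all add: sconj_real_def sre_real_def power2_eq_square)
end

instantiation complex :: real_or_complex
begin
definition sconj_complex :: "complex \<Rightarrow> complex" where "sconj_complex z = cnj z"
definition sre_complex :: "complex \<Rightarrow> real" where "sre_complex z = Re z"
instance
  by standard (simp_all add: sconj_complex_def sre_complex_def complex_eq_iff cmod_power2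
      flip: power2_eq_square)
end

(* A normed space over 'k: the library's real normed space together with a compatible
   multiplication by scalars from 'k (for 'k = real this is necessarily scaleR). *)
locale normed_space_over = vector_space scale
  for scale :: "'k::real_or_complex \<Rightarrow> 'v::real_normed_vector \<Rightarrow> 'v" +
  assumes norm_scale: "norm (scale c v) = norm c * norm v"
    and scale_of_real: "scale (of_real r) v = r *\<^sub>R v"

locale hilbert_space_over = normed_space_over scale
  for scale :: "'k::real_or_complex \<Rightarrow> 'h::banach \<Rightarrow> 'h" +
  fixes ip :: "'h \<Rightarrow> 'h \<Rightarrow> 'k"
  assumes ip_add_left: "ip (x + y) z = ip x z + ip y z"
    and ip_scale_left: "ip (scale c x) y = c * ip x y"
    and ip_commute: "ip y x = sconj (ip x y)"
    and ip_self: "ip x x = of_real ((norm x)\<^sup>2)"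

definition continuous_embedding ::
    "('k::real_or_complex \<Rightarrow> 'e::real_normed_vector \<Rightarrow> 'e) \<Rightarrow>
     ('k \<Rightarrow> 'h::real_normed_vector \<Rightarrow> 'h) \<Rightarrow> ('e \<Rightarrow> 'h) \<Rightarrow> bool" where
  "continuous_embedding scE scH \<iota> \<longleftrightarrow>
     Vector_Spaces.linear scE scH \<iota> \<and> inj \<iota> \<and> bounded_linear \<iota>"

definition subspace_of_dim ::
    "('k::field \<Rightarrow> 'e::ab_group_add \<Rightarrow> 'e) \<Rightarrow> nat \<Rightarrow> 'e set \<Rightarrow> bool" where
  "subspace_of_dim sc j S \<longleftrightarrow>
     (\<exists>B. finite B \<and> card B = j \<and> \<not> module.dependent sc B \<and> module.span sc B = S)"

definition semiflow :: "(real \<Rightarrow> 'q::metric_space \<Rightarrow> 'q) \<Rightarrow> bool" where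
  "semiflow \<theta> \<longleftrightarrow>
     (\<forall>q. \<theta> 0 q = q) \<and>
     (\<forall>t\<ge>0. \<forall>s\<ge>0. \<forall>q. \<theta> (t + s) q = \<theta> t (\<theta> s q)) \<and>
     continuous_on ({0..} \<times> UNIV) (\<lambda>(t, q). \<theta> t q)"

definition semicocycle ::
    "(real \<Rightarrow> 'q::metric_space \<Rightarrow> 'q) \<Rightarrow>
     (real \<Rightarrow> 'q \<Rightarrow> 'e::real_normed_vector \<Rightarrow> 'e) \<Rightarrow> bool" where
  "semicocycle \<theta> \<psi> \<longleftrightarrow>
     (\<forall>q v. \<psi> 0 q v = v) \<and>
     (\<forall>t\<ge>0. \<forall>s\<ge>0. \<forall>q v. \<psi> (t + s) q v = \<psi> t (\<theta> s q) (\<psi> s q v)) \<and>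
     continuous_on ({0..} \<times> UNIV) (\<lambda>(t, q, v). \<psi> t q v)"

(* Elements of the dual are the conjugate-linear bounded functionals.  Such an f has type
   'e =>L 'k (bounded and real-linear; conjugate-linearity is imposed below), and the
   pairing of v with f is f applied to v.  The operator norms of the real-linear function
   spaces agree with those over 'k. *)
type_synonym ('e, 'k) form_operator = "'e \<Rightarrow>\<^sub>L ('e \<Rightarrow>\<^sub>L 'k)"

definition pairing ::
    "'e::real_normed_vector \<Rightarrow> ('e \<Rightarrow>\<^sub>L 'k::real_normed_vector) \<Rightarrow> 'k" where
  "pairing v f = blinfun_apply f v"

definition symmetric_operator ::
    "('k::real_or_complex \<Rightarrow> 'e::real_normed_vector \<Rightarrow> 'e) \<Rightarrow> ('e, 'k) form_operator \<Rightarrow> bool" where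
  "symmetric_operator sc A \<longleftrightarrow>
     (\<forall>c v w. pairing (sc c w) (blinfun_apply A v) = sconj c * pairing w (blinfun_apply A v)) \<and>
     (\<forall>c v w. pairing w (blinfun_apply A (sc c v)) = c * pairing w (blinfun_apply A v)) \<and>
     (\<forall>v w. pairing v (blinfun_apply A w) = sconj (pairing w (blinfun_apply A v)))"

(* The pairing below is real for symmetric A, so sre only changes the type. *)
definition qform :: "('e::real_normed_vector, 'k::real_or_complex) form_operator \<Rightarrow> 'e \<Rightarrow> real" where
  "qform A v = sre (pairing v (blinfun_apply A v))"

definition quadratic_family ::
    "('k::real_or_complex \<Rightarrow> 'e::real_normed_vector \<Rightarrow> 'e) \<Rightarrow> nat \<Rightarrow>
     ('q \<Rightarrow> ('e, 'k) form_operator) \<Rightarrow> ('q \<Rightarrow> 'e set) \<Rightarrow> bool" where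
  "quadratic_family sc j Q Em \<longleftrightarrow>
     (\<forall>q. symmetric_operator sc (Q q) \<and>
          subspace_of_dim sc j (Em q) \<and>
          (\<forall>v\<in>Em q. v \<noteq> 0 \<longrightarrow> qform (Q q) v < 0) \<and>
          (\<exists>F. closed F \<and> module.subspace sc F \<and>
               F \<inter> Em q = {0} \<and> {x + y | x y. x \<in> F \<and> y \<in> Em q} = UNIV \<and>
               (\<forall>v\<in>F. v \<noteq> 0 \<longrightarrow> qform (Q q) v > 0))) \<and>
     bdd_above (range (\<lambda>q. norm (Q q)))"

(* The orthogonal projector onto N = E^-(q).  The second condition determines it because
   the form is negative definite on the finite-dimensional space N. *)
definition projector ::
    "('e::real_normed_vector, 'k::real_or_complex) form_operator \<Rightarrow> 'e set \<Rightarrow> 'e \<Rightarrow>\<^sub>L 'e" where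
  "projector A N = (THE P. (\<forall>v. blinfun_apply P v \<in> N) \<and>
     (\<forall>v. \<forall>w\<in>N. pairing w (blinfun_apply A v) = pairing w (blinfun_apply A (blinfun_apply P v))))"

definition qform_kappa ::
    "real \<Rightarrow> ('e::real_normed_vector, 'k::real_or_complex) form_operator \<Rightarrow> 'e set \<Rightarrow> 'e \<Rightarrow> real" where
  "qform_kappa \<kappa> A N v =
     (let p = blinfun_apply (projector A N) v in qform A (v - p) + \<kappa>\<^sup>2 * qform A p)"

(* The constant C_q and its inverse.  The infimum is taken in ereal: for j = 0 it runs over the empty
   set, so that C_q is infinite and its inverse 0.  For j > 0 it is a positive real. *)
definition C_const :: "('e::real_normed_vector, 'k::real_or_complex) form_operator \<Rightarrow> 'e set \<Rightarrow> ereal" where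
  "C_const A N = (INF \<zeta>\<in>{\<zeta>\<in>N. norm \<zeta> = 1}. ereal (sqrt (- qform A \<zeta>)))"

definition C_inv :: "('e::real_normed_vector, 'k::real_or_complex) form_operator \<Rightarrow> 'e set \<Rightarrow> real" where
  "C_inv A N = real_of_ereal (inverse (C_const A N))"

definition rate_integral ::
    "(real \<Rightarrow> 'q \<Rightarrow> 'q) \<Rightarrow> ('q \<Rightarrow> real) \<Rightarrow> real \<Rightarrow> 'q \<Rightarrow> real" where
  "rate_integral \<theta> a t q = (LBINT s:{0..t}. a (\<theta> s q))"

definition bounded_rate :: "('q::topological_space \<Rightarrow> real) \<Rightarrow> bool" where
  "bounded_rate a \<longleftrightarrow>
     a \<in> borel_measurable borel \<and> (\<exists>a1 a2. a1 < a2 \<and> (\<forall>q. a q \<in> {a1..a2}))"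

definition squeezing_estimate ::
    "(real \<Rightarrow> 'q \<Rightarrow> 'q) \<Rightarrow> (real \<Rightarrow> 'q \<Rightarrow> 'e::real_normed_vector \<Rightarrow> 'e) \<Rightarrow>
     ('q \<Rightarrow> ('e, 'k::real_or_complex) form_operator) \<Rightarrow> ('e \<Rightarrow> 'h::real_normed_vector) \<Rightarrow>
     ('q \<Rightarrow> real) \<Rightarrow> real \<Rightarrow> real \<Rightarrow> 'q \<Rightarrow> 'e \<Rightarrow> 'e \<Rightarrow> bool" where
  "squeezing_estimate \<theta> \<psi> Q \<iota> a \<delta> r q v1 v2 \<longleftrightarrow>
     exp (2 * rate_integral \<theta> a r q) * qform (Q (\<theta> r q)) (\<psi> r q v1 - \<psi> r q v2)
       - qform (Q q) (v1 - v2)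
     \<le> - \<delta> * (LBINT s:{0..r}. exp (2 * rate_integral \<theta> a s q)
                               * (norm (\<iota> (\<psi> s q v1) - \<iota> (\<psi> s q v2)))\<^sup>2)"

definition negative_squeezing ::
    "(real \<Rightarrow> 'q::topological_space \<Rightarrow> 'q) \<Rightarrow> (real \<Rightarrow> 'q \<Rightarrow> 'e::real_normed_vector \<Rightarrow> 'e) \<Rightarrow>
     ('q \<Rightarrow> ('e, 'k::real_or_complex) form_operator) \<Rightarrow> ('e \<Rightarrow> 'h::real_normed_vector) \<Rightarrow>
     ('q \<Rightarrow> real) \<Rightarrow> real \<Rightarrow> real \<Rightarrow> bool" where
  "negative_squeezing \<theta> \<psi> Q \<iota> \<alpha>0 \<delta> \<tau> \<longleftrightarrow>
     bounded_rate \<alpha>0 \<and>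
     (\<forall>q v1 v2. \<forall>r\<ge>\<tau>. qform (Q q) (v1 - v2) \<le> 0 \<longrightarrow>
        squeezing_estimate \<theta> \<psi> Q \<iota> \<alpha>0 \<delta> r q v1 v2)"

definition positive_squeezing ::
    "(real \<Rightarrow> 'q::topological_space \<Rightarrow> 'q) \<Rightarrow> (real \<Rightarrow> 'q \<Rightarrow> 'e::real_normed_vector \<Rightarrow> 'e) \<Rightarrow>
     ('q \<Rightarrow> ('e, 'k::real_or_complex) form_operator) \<Rightarrow> ('e \<Rightarrow> 'h::real_normed_vector) \<Rightarrow>
     ('q \<Rightarrow> real) \<Rightarrow> real \<Rightarrow> real \<Rightarrow> bool" where
  "positive_squeezing \<theta> \<psi> Q \<iota> \<beta>0 \<delta> \<tau> \<longleftrightarrow>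
     bounded_rate \<beta>0 \<and>
     (\<forall>q v1 v2. \<forall>r\<ge>\<tau>. qform (Q (\<theta> r q)) (\<psi> r q v1 - \<psi> r q v2) \<ge> 0 \<longrightarrow>
        squeezing_estimate \<theta> \<psi> Q \<iota> \<beta>0 \<delta> r q v1 v2)"

definition uniformly_Lipschitz ::
    "(real \<Rightarrow> 'q \<Rightarrow> 'e::real_normed_vector \<Rightarrow> 'e) \<Rightarrow> ('e \<Rightarrow> 'h::real_normed_vector) \<Rightarrow> bool" where
  "uniformly_Lipschitz \<psi> \<iota> \<longleftrightarrow>
     (\<exists>\<tau>S\<ge>0. \<forall>T>0. \<exists>L>0. \<forall>q v1 v2.
        (\<forall>t\<in>{\<tau>S..\<tau>S + T}. norm (\<psi> t q v1 - \<psi> t q v2) \<le> L * norm (\<iota> v1 - \<iota> v2)) \<and>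
        (\<forall>t\<in>{0..T}. norm (\<psi> t q v1 - \<psi> t q v2) \<le> L * norm (v1 - v2)))"

definition bounded_projectors ::
    "('q \<Rightarrow> ('e::real_normed_vector, 'k::real_or_complex) form_operator) \<Rightarrow> ('q \<Rightarrow> 'e set) \<Rightarrow> bool" where
  "bounded_projectors Q Em \<longleftrightarrow> bdd_above (range (\<lambda>q. norm (projector (Q q) (Em q))))"

definition positive_class ::
    "(real \<Rightarrow> 'q \<Rightarrow> 'q) \<Rightarrow> (real \<Rightarrow> 'q \<Rightarrow> 'e::real_normed_vector \<Rightarrow> 'e) \<Rightarrow>
     ('q \<Rightarrow> ('e, 'k::real_or_complex) form_operator) \<Rightarrow> 'q \<Rightarrow> 'e \<Rightarrow> 'e set" where
  "positive_class \<theta> \<psi> Q q v0 =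
     {v. \<forall>t\<ge>0. qform (Q (\<theta> t q)) (\<psi> t q v - \<psi> t q v0) \<ge> 0}"

definition admissible ::
    "real \<Rightarrow> ('e::real_normed_vector, 'k::real_or_complex) form_operator \<Rightarrow> 'e set \<Rightarrow> 'e set \<Rightarrow> bool" where
  "admissible \<kappa> A N M \<longleftrightarrow>
     (\<forall>v1\<in>M. \<forall>v2\<in>M. qform_kappa \<kappa> A N (v1 - v2) \<le> 0) \<and>
     (\<exists>g. homeomorphism M N (blinfun_apply (projector A N)) g)"

definition Lipschitz_admissible ::
    "real \<Rightarrow> real \<Rightarrow> ('e::real_normed_vector, 'k::real_or_complex) form_operator \<Rightarrow>
     'e set \<Rightarrow> 'e set \<Rightarrow> bool" where
  "Lipschitz_admissible L \<kappa> A N M \<longleftrightarrow>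
     admissible \<kappa> A N M \<and> L-lipschitz_on N (inv_into M (blinfun_apply (projector A N)))"

(* A function from triples of nonnegative reals to nonnegative reals, non-decreasing in each
   variable; its values at other arguments are irrelevant. *)
definition nondecreasing3 :: "(real \<Rightarrow> real \<Rightarrow> real \<Rightarrow> real) \<Rightarrow> bool" where
  "nondecreasing3 R \<longleftrightarrow>
     (\<forall>a\<ge>0. \<forall>b\<ge>0. \<forall>c\<ge>0. R a b c \<ge> 0) \<and>
     (\<forall>b\<ge>0. \<forall>c\<ge>0. mono_on {0..} (\<lambda>a. R a b c)) \<and>
     (\<forall>a\<ge>0. \<forall>c\<ge>0. mono_on {0..} (\<lambda>b. R a b c)) \<and>
     (\<forall>a\<ge>0. \<forall>b\<ge>0. mono_on {0..} (\<lambda>c. R a b c))"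

(* The squeezing hypotheses do not relate the rates alpha and beta, and if
   alpha(t;q) - beta(t;q) tends to infinity, an admissible set can contain many points
   positively equivalent to v0.  Example: Q a point, E = H = R^2, V(x,y) = x^2 - y^2 and
     x' = -2 sin x,   y' = 3 y - (2 + 2 cos x) eta(y),
   where eta is odd, smooth, 0 <= eta' <= 1, |eta| <= 1/4 and eta(y) = y for |y| <= 1/8.
   Both squeezing properties hold with alpha0 = 10, beta0 = -10, delta = 1/2, tau = 0;
   M = {x = 2 pi} is admissible; and every (2 pi, y) with |y| <= 1/8 is positively
   equivalent to v0 = (0,0).  So uniqueness needs the following condition.  It holds in
   particular if alpha0 <= beta0 pointwise. *)
definition rates_compatible ::
    "(real \<Rightarrow> 'q \<Rightarrow> 'q) \<Rightarrow> ('q \<Rightarrow> real) \<Rightarrow> ('q \<Rightarrow> real) \<Rightarrow> 'q \<Rightarrow> bool" where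
  "rates_compatible \<theta> \<alpha>0 \<beta>0 q \<longleftrightarrow>
     \<not> filterlim (\<lambda>t. rate_integral \<theta> \<alpha>0 t q - rate_integral \<theta> \<beta>0 t q) at_top at_top"

end

theory Submission
  imports Defs "HOL-Homology.Invariance_of_Domain"
begin

text \<open>
  Write \<open>V\<^sub>t\<close> for the form at time \<open>t\<close> along the orbit of \<open>q\<close>, \<open>d t\<close> for the difference of two trajectories
  over that orbit, and measure vectors by \<open>sqrt (- V)\<close> of their component in \<open>E\<^sup>-\<close> and \<open>sqrt V\<close> of
  their component in \<open>E\<^sup>+\<close>.

  Existence. Negative squeezing sends the cone \<open>V < 0\<close> into itself after time \<open>\<tau>\<close>. Contrapositively, a
  difference with \<open>V\<^sub>T \<ge> 0\<close> had \<open>V\<^sub>t \<ge> 0\<close> at all \<open>t \<le> T - \<tau>\<close>. So it is enough to find, for each large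
  \<open>T\<close>, a point \<open>w\<^sub>T\<close> of \<open>M\<close> whose image at time \<open>T\<close> has the same projection to \<open>E\<^sup>-\<close> as the image of
  \<open>v0\<close>, since the difference then lies in \<open>E\<^sup>+\<close>, and to let \<open>T\<close> tend to infinity. Transporting \<open>M\<close> by the
  flow and projecting gives a continuous map between two subspaces of the same finite dimension. Negative
  squeezing makes it expand distances by a fixed factor, so its image is closed; by invariance of domain
  its image is open; hence the map is onto (\<open>expanding_map_onto\<close>, \<open>admissible_reaches_projection\<close>).
  Since differences within \<open>M\<close> lie in a cone strictly inside \<open>V \<le> 0\<close>, while \<open>w\<^sub>T - v0\<close> satisfies \<open>V \<ge> 0\<close>,
  the projections of the \<open>w\<^sub>T\<close> stay bounded (\<open>neg_norm_cone_bound\<close>), and a limit point works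
  (\<open>admissible_meets_class\<close>).

  Decay. If \<open>V\<^sub>t \<ge> 0\<close> for all \<open>t\<close>, positive squeezing bounds the integral over all times of
  \<open>exp (2 * \<beta>)\<close> times the squared norm of \<open>d\<close> in the Hilbert space by \<open>V\<^sub>0 (d 0) / \<delta>\<close>. The smoothing part of the
  Lipschitz property turns a piece of this integral over a time interval of length one into a pointwise
  bound on the norm of \<open>d t\<close> in \<open>E\<close> (\<open>smoothing\<close>, \<open>class_decay\<close>). The same cone argument as above bounds the
  distance from \<open>v0\<close> to the selected point by a multiple of the distance from \<open>v0\<close> to \<open>M\<close>
  (\<open>class_distance_le_infdist\<close>).

  Uniqueness. The tails of a convergent integral vanish, so the difference of two points of \<open>M\<close> in the
  class of \<open>v0\<close> has norm \<open>o(exp (- \<beta>))\<close> along the orbit. If the points differ, the difference starts in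
  \<open>V < 0\<close>, and negative squeezing keeps \<open>- V\<^sub>t\<close> above a positive multiple of \<open>exp (- 2 * \<alpha>)\<close>. Both together
  force \<open>\<alpha> - \<beta>\<close> to infinity, which compatible rates exclude (\<open>admissible_class_unique\<close>).
\<close>

section \<open>Real structure of the quadratic forms\<close>

text \<open>
  The scalar \<open>x\<close> and its conjugate are the roots of a real polynomial: their sum is \<open>2 * sre x\<close> and their
  product is the square of the norm.
\<close>

lemma real_or_complex_quadratic:
  fixes x :: "'k::real_or_complex"
  shows "x * x = (2 * sre x) *\<^sub>R x - ((norm x)\<^sup>2) *\<^sub>R 1"
proof -
  have "sconj x = (2 * sre x) *\<^sub>R 1 - x"
  proof -
    have "(2 * sre x) *\<^sub>R (1::'k) = 2 * (sre x *\<^sub>R 1)"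
      by (simp add: scaleR_conv_of_real)
    also have "\<dots> = x + sconj x" by (simp add: sre_eq)
    finally show ?thesis by simp
  qed
  with mult_sconj[of x] have "x * ((2 * sre x) *\<^sub>R 1 - x) = ((norm x)\<^sup>2) *\<^sub>R 1" by simp
  then show ?thesis by (simp add: algebra_simps)
qed

text \<open>
  Every scalar has degree at most two over the reals, so completing the square writes it as a real number
  plus a real multiple of a square root of \<open>- 1\<close>. A field has at most two such roots, hence \<open>1\<close> and one
  of them, if there is any, span. This makes finite-dimensional spaces over the scalars finite-dimensional over the reals,
  where orthonormal bases and invariance of domain are used.
\<close>

lemma real_or_complex_finite_dim:
  "\<exists>K::'k::real_or_complex set. finite K \<and> span K = UNIV"
proof -
  have shift: "\<exists>s::real. \<exists>r::real. (x - of_real s) * (x - of_real s) = of_real r" for x :: 'k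
  proof (intro exI)
    show "(x - of_real (sre x)) * (x - of_real (sre x)) = of_real ((sre x)\<^sup>2 - (norm x)\<^sup>2)"
      using real_or_complex_quadratic[of x]
      by (simp add: algebra_simps scaleR_conv_of_real power2_eq_square)
  qed
  have dich: "(\<exists>s. x = of_real s) \<or> (\<exists>s c y. x = of_real s + of_real c * y \<and> y * y = -1)" for x :: 'k
  proof -
    obtain s r where sr: "(x - of_real s) * (x - of_real s) = of_real r" using shift by blast
    show ?thesis
    proof (cases "r \<ge> 0")
      case True
      then have "of_real r = (of_real (sqrt r) * of_real (sqrt r) :: 'k)"
        by (metis of_real_mult real_sqrt_mult_self abs_of_nonneg)
      then have "x - of_real s = of_real (sqrt r) \<or> x - of_real s = - of_real (sqrt r)"
        using sr square_eq_iff[of "x - of_real s" "of_real (sqrt r)"] by simp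
      then have "x = of_real (s + sqrt r) \<or> x = of_real (s - sqrt r)"
        by (auto simp: algebra_simps)
      then show ?thesis by blast
    next
      case False
      define c where "c = sqrt (- r)"
      have c: "c \<noteq> 0" "c * c = - r" using False by (auto simp: c_def)
      define y where "y = (x - of_real s) / of_real c"
      have "y * y = (x - of_real s) * (x - of_real s) / of_real (c * c)" by (simp add: y_def)
      also have "\<dots> = -1" using sr c False by simp
      finally have "y * y = -1" .
      moreover have "x = of_real s + of_real c * y" using c by (simp add: y_def)
      ultimately show ?thesis by blast
    qed
  qed
  show ?thesis
  proof (cases "\<exists>i::'k. i * i = -1")
    case True
    then obtain i :: 'k where i: "i * i = -1" by blast
    have "x \<in> span {1, i}" for x :: 'k
    proof -
      have one: "of_real s \<in> span {1, i}" for s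
        by (simp add: of_real_def span_base span_scale)
      have "x \<in> span {1, i}" if "x = of_real s + of_real c * y" "y * y = -1" for s c y
      proof -
        have "y = i \<or> y = - i" using that i square_eq_iff[of y i] by simp
        then have "y \<in> span {1, i}" by (auto intro: span_base span_neg)
        then show ?thesis
          unfolding that by (intro span_add one) (simp add: span_scale flip: scaleR_conv_of_real)
      qed
      with dich[of x] one show ?thesis by blast
    qed
    then show ?thesis by (intro exI[of _ "{1, i}"]) auto
  next
    case False
    have "x \<in> span {1}" for x :: 'k
      using dich[of x] False by (auto simp: of_real_def span_base span_scale)
    then show ?thesis by (intro exI[of _ "{1}"]) auto
  qed
qed

lemma finite_real_span_of_subspace_of_dim:
  assumes "normed_space_over sc" "subspace_of_dim sc j S"
  shows "\<exists>D. finite D \<and> span D = S"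
proof -
  interpret normed_space_over sc by fact
  obtain B where B: "finite B" "module.span sc B = S"
    using assms(2) by (auto simp: subspace_of_dim_def)
  obtain K :: "'a set" where K: "finite K" "Real_Vector_Spaces.span K = UNIV" using real_or_complex_finite_dim by blast
  define D where "D = (\<lambda>(k, b). sc k b) ` (K \<times> B)"
  have sc_scaleR: "sc (r *\<^sub>R k) v = r *\<^sub>R sc k v" for k r v
    by (metis scaleR_conv_of_real scale_of_real scale_scale)
  have all: "sc k b \<in> Real_Vector_Spaces.span D" if "b \<in> B" for k b
  proof -
    have "k \<in> Real_Vector_Spaces.span K" using K by simp
    then show ?thesis
    proof (induction rule: Real_Vector_Spaces.span_induct_alt)
      case base
      show ?case by (simp add: Real_Vector_Spaces.span_zero)
    next
      case (step c x y)
      then have "sc x b \<in> D" using that by (auto simp: D_def)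
      then show ?case using step
        by (simp add: scale_left_distrib sc_scaleR Real_Vector_Spaces.span_add
            Real_Vector_Spaces.span_scale Real_Vector_Spaces.span_base)
    qed
  qed
  have "Real_Vector_Spaces.span D = S"
  proof
    have "Real_Vector_Spaces.subspace S"
      unfolding Real_Vector_Spaces.subspace_def using B
      by (metis scale_of_real span_add span_scale span_zero)
    moreover have "D \<subseteq> S" using B by (auto simp: D_def intro: span_scale span_base)
    ultimately show "Real_Vector_Spaces.span D \<subseteq> S"
      by (simp add: Real_Vector_Spaces.span_minimal)
  next
    have "x \<in> Real_Vector_Spaces.span D" if "x \<in> span B" for x
      using that
    proof (induction rule: span_induct_alt)
      case base
      show ?case by (simp add: Real_Vector_Spaces.span_zero)
    next
      case (step c x y)
      then show ?case by (intro Real_Vector_Spaces.span_add all) auto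
    qed
    then show "S \<subseteq> Real_Vector_Spaces.span D" using B by auto
  qed
  then show ?thesis using B K by (intro exI[of _ D]) (auto simp: D_def)
qed

text \<open>
  A bijection between bases over the scalars extends to an isomorphism, which is in particular linear over
  the reals. It serves to show that the fibres have one common real dimension without computing it.
\<close>

lemma subspace_of_dim_real_isomorphism:
  assumes "normed_space_over sc" "subspace_of_dim sc j S" "subspace_of_dim sc j T"
  shows "\<exists>f. linear f \<and> inj_on f S \<and> f ` S = T"
proof -
  interpret normed_space_over sc by fact
  interpret P: vector_space_pair sc sc by unfold_locales
  obtain B where B: "finite B" "card B = j" "independent B" "span B = S"
    using assms(2) by (auto simp: subspace_of_dim_def)
  obtain C where C: "finite C" "card C = j" "independent C" "span C = T"
    using assms(3) by (auto simp: subspace_of_dim_def)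
  obtain h where h: "bij_betw h B C" using B C by (metis finite_same_card_bij)
  obtain g where g: "Vector_Spaces.linear sc sc g" "\<forall>x\<in>B. g x = h x"
    using P.linear_independent_extend[OF B(3)] by blast
  interpret g: Vector_Spaces.linear sc sc g by fact
  have gB: "g ` B = C" using h g(2) by (auto simp: bij_betw_def)
  have "inj_on g B" using h g(2) by (simp add: bij_betw_def cong: inj_on_cong)
  then have "inj_on g S"
    using P.linear_inj_on_span_independent_image[OF g(1), of B] C gB B by simp
  moreover have "g ` S = T" using P.linear_span_image[OF g(1), of B] gB B C by simp
  moreover have "linear g"
    by (rule linearI) (simp_all add: g.add g.scale flip: scale_of_real)
  ultimately show ?thesis by blast
qed

text \<open>The real part of the sesquilinear form: the real symmetric bilinear form that polarizes \<open>qform\<close>.\<close>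
definition rform :: "('e::real_normed_vector, 'k::real_or_complex) form_operator \<Rightarrow> 'e \<Rightarrow> 'e \<Rightarrow> real" where
  "rform A v w = sre (pairing v (blinfun_apply A w))"

lemma qform_rform: "qform A v = rform A v v"
  by (simp add: qform_def rform_def)

text \<open>
  By symmetry of the operator the conjugate of one pairing is the pairing with the arguments exchanged.
  The right-hand side is visibly additive and real-homogeneous in both arguments, which gives bilinearity
  of the form without any additivity of the conjugation.
\<close>

lemma rform_eq:
  fixes A :: "('e::real_normed_vector, 'k::real_or_complex) form_operator"
  assumes "symmetric_operator sc A"
  shows "(2 * rform A v w) *\<^sub>R (1::'k) =
    pairing v (blinfun_apply A w) + pairing w (blinfun_apply A v)"
proof -
  have "pairing w (blinfun_apply A v) = sconj (pairing v (blinfun_apply A w))"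
    using assms unfolding symmetric_operator_def by blast
  moreover have "(2 * rform A v w) *\<^sub>R (1::'k) = 2 * (sre (pairing v (blinfun_apply A w)) *\<^sub>R 1)"
    by (simp add: scaleR_conv_of_real rform_def)
  moreover have "2 * (sre z *\<^sub>R 1) = z + sconj z" for z :: 'k
    unfolding sre_eq by simp
  ultimately show ?thesis by simp
qed

lemma rform_sym:
  fixes A :: "('e::real_normed_vector, 'k::real_or_complex) form_operator"
  assumes "symmetric_operator sc A" shows "rform A v w = rform A w v"
proof -
  have "(2 * rform A v w) *\<^sub>R (1::'k) = (2 * rform A w v) *\<^sub>R 1"
    unfolding rform_eq[OF assms] by (simp add: add.commute)
  then show ?thesis by simp
qed

lemma rform_bound:
  fixes A :: "('e::real_normed_vector, 'k::real_or_complex) form_operator"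
  assumes "symmetric_operator sc A"
  shows "\<bar>rform A v w\<bar> \<le> norm A * norm v * norm w"
proof -
  have p: "norm (pairing x (blinfun_apply A y)) \<le> norm A * norm x * norm y" for x y
  proof -
    have "norm (pairing x (blinfun_apply A y)) \<le> norm (blinfun_apply A y) * norm x"
      unfolding pairing_def by (rule norm_blinfun)
    also have "\<dots> \<le> (norm A * norm y) * norm x"
      by (intro mult_right_mono norm_blinfun) auto
    finally show ?thesis by (simp add: mult_ac)
  qed
  have "2 * \<bar>rform A v w\<bar> = norm ((2 * rform A v w) *\<^sub>R (1::'k))" by simp
  also have "\<dots> \<le> norm A * norm v * norm w + norm A * norm w * norm v"
    unfolding rform_eq[OF assms] by (intro norm_triangle_mono p)
  finally show ?thesis by (simp add: mult_ac)
qed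

lemma bounded_bilinear_rform:
  fixes A :: "('e::real_normed_vector, 'k::real_or_complex) form_operator"
  assumes "symmetric_operator sc A"
  shows "bounded_bilinear (rform A)"
proof
  fix a a' b b' r
  have inj: "x = y" if "(2 * x) *\<^sub>R (1::'k) = (2 * y) *\<^sub>R 1" for x y :: real
    using that by simp
  show add: "rform A (a + a') b = rform A a b + rform A a' b" for a a' b
    by (rule inj) (simp add: rform_eq[OF assms] distrib_left scaleR_add_left,
        simp add: pairing_def blinfun.add_left blinfun.add_right)
  show "rform A a (b + b') = rform A a b + rform A a b'"
    using add by (simp add: rform_sym[OF assms, of a])
  have p: "(2 * (r * x)) *\<^sub>R (1::'k) = r *\<^sub>R ((2 * x) *\<^sub>R 1)" for r x by (simp add: mult_ac)
  show sc: "rform A (r *\<^sub>R a) b = r *\<^sub>R rform A a b" for a b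
    by (rule inj) (simp only: real_scaleR_def p rform_eq[OF assms],
        simp add: pairing_def blinfun.scaleR_left blinfun.scaleR_right scaleR_add_right)
  show "rform A a (r *\<^sub>R b) = r *\<^sub>R rform A a b"
    using sc by (simp add: rform_sym[OF assms, of a])
next
  show "\<exists>K. \<forall>a b. norm (rform A a b) \<le> norm a * norm b * K"
    using rform_bound[OF assms] by (intro exI[of _ "norm A"]) (simp add: mult_ac)
qed

section \<open>Orthonormal frames of negative definite subspaces\<close>

text \<open>
  The Minkowski inequality for a form that may be degenerate. Perturbing the two seminorms to strictly
  larger positive numbers \<open>s\<close> and \<open>t\<close> avoids the case where one of them vanishes: positivity on
  \<open>t *\<^sub>R x - s *\<^sub>R y\<close> is then the Cauchy-Schwarz inequality \<open>c x y \<le> s * t\<close>.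
\<close>

lemma sqrt_semidefinite_triangle:
  fixes c :: "'a::real_normed_vector \<Rightarrow> 'a \<Rightarrow> real"
  assumes "bounded_bilinear c" and sym: "\<And>x y. c x y = c y x" and psd: "\<And>x. c x x \<ge> 0"
  shows "sqrt (c (x + y) (x + y)) \<le> sqrt (c x x) + sqrt (c y y)"
proof -
  interpret bounded_bilinear c by fact
  have main: "sqrt (c (x + y) (x + y)) \<le> s + t"
    if s: "s > sqrt (c x x)" and t: "t > sqrt (c y y)" for s t
  proof -
    have pos: "s > 0" "t > 0" using s t psd[of x] psd[of y] real_sqrt_ge_zero by (smt (verit))+
    have sq: "c x x \<le> s * s" "c y y \<le> t * t"
      using s t pos psd sqrt_le_D[of _ s] sqrt_le_D[of _ t] by (auto simp: power2_eq_square)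
    have "0 \<le> c (t *\<^sub>R x - s *\<^sub>R y) (t *\<^sub>R x - s *\<^sub>R y)" by (rule psd)
    also have "\<dots> = t * t * c x x - 2 * (s * t) * c x y + s * s * c y y"
      by (simp add: diff_left diff_right scaleR_left scaleR_right sym[of y x] algebra_simps)
    also have "\<dots> \<le> t * t * (s * s) - 2 * (s * t) * c x y + s * s * (t * t)"
      using sq pos by (intro add_mono diff_mono mult_left_mono) auto
    also have "\<dots> = 2 * (s * t) * (s * t - c x y)" by (simp add: algebra_simps)
    finally have "c x y \<le> s * t" using pos by (smt (verit) zero_le_mult_iff mult_pos_pos)
    then have "c (x + y) (x + y) \<le> (s + t)\<^sup>2"
      using sq by (simp add: add_left add_right sym[of y x] power2_eq_square algebra_simps)
    then show ?thesis using pos by (intro real_le_lsqrt) auto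
  qed
  show ?thesis
  proof (rule field_le_epsilon)
    fix \<epsilon> :: real assume "\<epsilon> > 0"
    then have "sqrt (c (x + y) (x + y)) \<le> (sqrt (c x x) + \<epsilon> / 2) + (sqrt (c y y) + \<epsilon> / 2)"
      by (intro main) auto
    then show "sqrt (c (x + y) (x + y)) \<le> sqrt (c x x) + sqrt (c y y) + \<epsilon>" by simp
  qed
qed

text \<open>An orthonormal basis for \<open>- b\<close> of a subspace on which \<open>b\<close> is negative definite. Coordinates in such a
  basis are the continuous functionals \<open>- b (e i)\<close>, so that projector, closedness and compactness of
  bounded sets in the subspace come without a general theory of finite-dimensional normed spaces.\<close>
locale negative_frame = bounded_bilinear b
  for b :: "'e::real_normed_vector \<Rightarrow> 'e \<Rightarrow> real" +
  fixes e :: "nat \<Rightarrow> 'e" and n :: nat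
  assumes sym: "b v w = b w v"
    and orthonormal: "i < n \<Longrightarrow> k < n \<Longrightarrow> b (e i) (e k) = (if i = k then -1 else 0)"
begin

abbreviation N :: "'e set" where "N \<equiv> span (e ` {..<n})"

definition prj :: "'e \<Rightarrow> 'e" where "prj v = (\<Sum>i<n. (- b (e i) v) *\<^sub>R e i)"

lemma sum_frame_in: "(\<Sum>i<n. x i *\<^sub>R e i) \<in> N"
  by (intro span_sum span_scale span_base) auto

lemma prj_in: "prj v \<in> N"
  unfolding prj_def by (rule sum_frame_in)

lemma coordinate_sum: "k < n \<Longrightarrow> b (e k) (\<Sum>i<n. x i *\<^sub>R e i) = - x k"
proof -
  assume k: "k < n"
  have "b (e k) (\<Sum>i<n. x i *\<^sub>R e i) = (\<Sum>i<n. x i * b (e k) (e i))"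
    by (simp add: sum_right scaleR_right)
  also have "\<dots> = (\<Sum>i<n. if i = k then - x k else 0)"
    by (intro sum.cong refl) (use k in \<open>simp add: orthonormal\<close>)
  also have "\<dots> = - x k" using k by simp
  finally show ?thesis .
qed

lemma coordinate_prj: "k < n \<Longrightarrow> b (e k) (prj v) = b (e k) v"
  unfolding prj_def using coordinate_sum[of k "\<lambda>i. - b (e i) v"] by simp

lemma bounded_linear_prj: "bounded_linear prj"
  unfolding prj_def
  by (intro bounded_linear_sum bounded_linear_scaleR_const bounded_linear_minus bounded_linear_right)

lemma prj_orthogonal: "w \<in> N \<Longrightarrow> b w (prj v) = b w v"
proof (induction rule: span_induct)
  case base
  then show ?case
    by (intro subspaceI) (auto simp: zero_left add_left scaleR_left)
next
  case (step x)
  then show ?case by (auto simp: coordinate_prj)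
qed

lemma prj_id: "v \<in> N \<Longrightarrow> prj v = v"
proof -
  interpret p: bounded_linear prj by (rule bounded_linear_prj)
  show "v \<in> N \<Longrightarrow> prj v = v"
  proof (induction rule: span_induct)
    case base
    show ?case by (intro subspaceI) (auto simp: p.zero p.add p.scaleR)
  next
    case (step x)
    then obtain k where k: "k < n" "x = e k" by auto
    have "prj (e k) = (\<Sum>i<n. if i = k then e k else 0)"
      unfolding prj_def by (intro sum.cong refl) (use k in \<open>simp add: orthonormal\<close>)
    then show ?case using k by simp
  qed
qed

lemma form_prj: "b (prj v) (prj v) = - (\<Sum>i<n. (b (e i) v)\<^sup>2)"
proof -
  have "b (prj v) (prj v) = b (prj v) v" by (rule prj_orthogonal[OF prj_in])
  also have "\<dots> = - (\<Sum>i<n. (b (e i) v)\<^sup>2)"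
    unfolding prj_def by (simp add: sum_left scaleR_left power2_eq_square sum_negf minus_left)
  finally show ?thesis .
qed

lemma form_on_frame: "v \<in> N \<Longrightarrow> b v v = - (\<Sum>i<n. (b (e i) v)\<^sup>2)"
  using form_prj[of v] by (simp add: prj_id)

lemma norm_le_form:
  assumes "v \<in> N"
  shows "norm v \<le> (\<Sum>i<n. norm (e i)) * sqrt (- b v v)"
proof -
  have "norm v = norm (prj v)" using assms by (simp add: prj_id)
  also have "\<dots> \<le> (\<Sum>i<n. \<bar>b (e i) v\<bar> * norm (e i))"
    unfolding prj_def by (rule order.trans[OF norm_sum]) simp
  also have "\<dots> \<le> (\<Sum>i<n. sqrt (- b v v) * norm (e i))"
  proof (intro sum_mono mult_right_mono)
    fix i assume "i \<in> {..<n}"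
    then have "(b (e i) v)\<^sup>2 \<le> (\<Sum>i<n. (b (e i) v)\<^sup>2)" by (intro member_le_sum) auto
    then have "(b (e i) v)\<^sup>2 \<le> - b v v" using form_on_frame[OF assms] by simp
    then show "\<bar>b (e i) v\<bar> \<le> sqrt (- b v v)" by (metis real_sqrt_abs real_sqrt_le_mono)
  qed auto
  finally show ?thesis by (simp add: sum_distrib_left mult.commute)
qed

lemma form_nonpos: "v \<in> N \<Longrightarrow> b v v \<le> 0"
  by (simp add: form_on_frame sum_nonneg)

lemma inj_frame: "inj_on e {..<n}"
proof (rule inj_onI)
  fix i k assume ik: "i \<in> {..<n}" "k \<in> {..<n}" "e i = e k"
  then have "b (e i) (e k) = -1" using orthonormal[of k k] by simp
  then show "i = k" using orthonormal[of i k] ik by (auto split: if_splits)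
qed

lemma independent_frame: "independent (e ` {..<n})"
proof (rule independent_if_scalars_zero)
  fix f x assume s: "(\<Sum>x\<in>e ` {..<n}. f x *\<^sub>R x) = 0" and "x \<in> e ` {..<n}"
  then obtain k where k: "k < n" "x = e k" by auto
  have "(\<Sum>i<n. f (e i) *\<^sub>R e i) = 0" using s by (simp add: sum.reindex[OF inj_frame])
  with coordinate_sum[OF k(1), of "\<lambda>i. f (e i)"] show "f x = 0" using k by (simp add: zero_right)
qed auto

lemma dim_frame: "dim N = n"
proof -
  have "dim (e ` {..<n}) = card (e ` {..<n})" by (rule dim_eq_card_independent[OF independent_frame])
  then show ?thesis by (simp add: card_image[OF inj_frame])
qed

lemma closed_frame: "closed N"
proof -
  interpret p: bounded_linear prj by (rule bounded_linear_prj)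
  have "N = {v. prj v = v}"
  proof (intro equalityI subsetI)
    fix v assume "v \<in> {v. prj v = v}"
    then show "v \<in> N" using prj_in[of v] by simp
  qed (simp add: prj_id)
  moreover have "closed {v. prj v = v}"
    by (intro closed_Collect_eq continuous_intros p.continuous_on)
  ultimately show ?thesis by simp
qed

text \<open>
  A bounded part of the subspace is contained in the image of a cube of coordinates, which is a sum of
  compact segments.
\<close>

lemma bounded_in_compact: "\<exists>K. compact K \<and> {v \<in> N. sqrt (- b v v) \<le> r} \<subseteq> K"
proof (intro exI conjI)
  define K where "K m = (\<lambda>x. \<Sum>i<m. x i *\<^sub>R e i) ` {x. \<forall>i<m. \<bar>x i\<bar> \<le> r}" for m
  show "compact (K n)"
  proof (induction n)
    case 0
    show ?case by (auto simp: K_def intro!: finite_imp_compact)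
  next
    case (Suc m)
    have "K (Suc m) = {x + y |x y. x \<in> K m \<and> y \<in> (\<lambda>c. c *\<^sub>R e m) ` {-r..r}}"
    proof (intro equalityI subsetI)
      fix v assume "v \<in> K (Suc m)"
      then obtain x where x: "\<forall>i<Suc m. \<bar>x i\<bar> \<le> r" "v = (\<Sum>i<Suc m. x i *\<^sub>R e i)"
        by (auto simp: K_def)
      have "(\<Sum>i<m. x i *\<^sub>R e i) \<in> K m" using x by (auto simp: K_def)
      moreover have "x m \<in> {-r..r}" using x(1) by (simp add: abs_le_iff) (metis lessI minus_le_iff)
      ultimately show "v \<in> {x + y |x y. x \<in> K m \<and> y \<in> (\<lambda>c. c *\<^sub>R e m) ` {-r..r}}"
        using x(2) by (intro CollectI exI[of _ "\<Sum>i<m. x i *\<^sub>R e i"] exI[of _ "x m *\<^sub>R e m"]) auto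
    next
      fix v assume "v \<in> {x + y |x y. x \<in> K m \<and> y \<in> (\<lambda>c. c *\<^sub>R e m) ` {-r..r}}"
      then obtain x c where x: "\<forall>i<m. \<bar>x i\<bar> \<le> r" "c \<in> {-r..r}" "v = (\<Sum>i<m. x i *\<^sub>R e i) + c *\<^sub>R e m"
        by (auto simp: K_def)
      then have "v = (\<Sum>i<Suc m. (x(m := c)) i *\<^sub>R e i)" by simp
      moreover have "\<forall>i<Suc m. \<bar>(x(m := c)) i\<bar> \<le> r" using x by (auto simp: less_Suc_eq)
      ultimately show "v \<in> K (Suc m)" unfolding K_def by blast
    qed
    moreover have "compact ((\<lambda>c. c *\<^sub>R e m) ` {-r..r})"
      by (intro compact_continuous_image continuous_intros) auto
    ultimately show ?case using compact_sums[OF Suc] by simp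
  qed
  show "{v \<in> N. sqrt (- b v v) \<le> r} \<subseteq> K n"
  proof
    fix v assume v: "v \<in> {v \<in> N. sqrt (- b v v) \<le> r}"
    have "\<bar>- b (e i) v\<bar> \<le> r" if "i < n" for i
    proof -
      have "(b (e i) v)\<^sup>2 \<le> (\<Sum>i<n. (b (e i) v)\<^sup>2)" using that by (intro member_le_sum) auto
      then have "(b (e i) v)\<^sup>2 \<le> - b v v" using form_on_frame v by simp
      then have "\<bar>b (e i) v\<bar> \<le> sqrt (- b v v)" by (metis real_sqrt_abs real_sqrt_le_mono)
      then show ?thesis using v by simp
    qed
    moreover have "v = (\<Sum>i<n. (- b (e i) v) *\<^sub>R e i)" using prj_id v by (simp add: prj_def)
    ultimately show "v \<in> K n" unfolding K_def
      by (intro image_eqI[of _ _ "\<lambda>i. - b (e i) v"]) auto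
  qed
qed

end

text \<open>
  The Gram-Schmidt process for \<open>- b\<close>: a new spanning vector is replaced by its normalized component
  orthogonal to the frame found so far, or dropped if that component vanishes.
\<close>

lemma gram_schmidt:
  fixes b :: "'e::real_normed_vector \<Rightarrow> 'e \<Rightarrow> real"
  assumes bb: "bounded_bilinear b" and sym: "\<And>v w. b v w = b w v"
    and "finite B" and neg: "\<And>v. v \<in> span B \<Longrightarrow> v \<noteq> 0 \<Longrightarrow> b v v < 0"
  shows "\<exists>e n. negative_frame b e n \<and> span (e ` {..<n}) = span B"
  using assms(3) neg
proof (induction B rule: finite_induct)
  case empty
  have "negative_frame b e 0" for e
    using bb sym by (auto simp: negative_frame_def negative_frame_axioms_def)
  then show ?case by (intro exI[of _ 0] exI) auto
next
  case (insert a B)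
  have sub: "span B \<subseteq> span (insert a B)" by (rule span_mono) auto
  then obtain e n where fr: "negative_frame b e n" and sp: "span (e ` {..<n}) = span B"
    using insert by blast
  interpret negative_frame b e n by fact
  show ?case
  proof (cases "a \<in> span B")
    case True
    then show ?thesis using fr sp by (metis span_redundant)
  next
    case False
    define u where "u = a - prj a"
    have prjB: "prj a \<in> span B" using prj_in sp by auto
    have u: "u \<in> span (insert a B)" "u \<noteq> 0"
      using prjB sub False by (auto simp: u_def intro: span_diff span_base)
    define c where "c = sqrt (- b u u)"
    have c: "c > 0" "c * c = - b u u" using insert.prems[OF u] by (auto simp: c_def)
    define e' where "e' = e(n := u /\<^sub>R c)"
    have orth: "b (e i) u = 0" if "i < n" for i
      using coordinate_prj[OF that, of a] by (simp add: u_def diff_right)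
    have "b u u = - (c * c)" using c by simp
    then have norm_u: "b (u /\<^sub>R c) (u /\<^sub>R c) = -1"
    proof -
      have "b (u /\<^sub>R c) (u /\<^sub>R c) = b u u / (c * c)"
        by (simp add: scaleR_left scaleR_right divide_inverse mult_ac)
      then show ?thesis using c(1) \<open>b u u = - (c * c)\<close> by simp
    qed
    have orth': "b (e i) (u /\<^sub>R c) = 0" "b (u /\<^sub>R c) (e i) = 0" if "i < n" for i
      using orth[OF that] sym[of u "e i"] by (simp_all add: scaleR_left scaleR_right)
    have "b (e' i) (e' k) = (if i = k then -1 else 0)" if "i < Suc n" "k < Suc n" for i k
    proof (cases "i = n")
      case True
      then show ?thesis using that orth'(2)[of k] norm_u by (cases "k = n") (simp_all add: e'_def)
    next
      case False
      then show ?thesis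
        using that orth'(1)[of i] orthonormal[of i k] by (cases "k = n") (simp_all add: e'_def)
    qed
    then have "negative_frame b e' (Suc n)"
      using bb assms(2) by (intro negative_frame.intro negative_frame_axioms.intro)
    moreover have "span (e' ` {..<Suc n}) = span (insert a B)"
    proof -
      have im: "e' ` {..<Suc n} = insert (u /\<^sub>R c) (e ` {..<n})"
        by (auto simp: e'_def lessThan_Suc)
      have BS: "span B \<subseteq> span (e' ` {..<Suc n})"
        unfolding im sp[symmetric] by (rule span_mono) auto
      have uS: "u /\<^sub>R c \<in> span (e' ` {..<Suc n})" unfolding im by (rule span_base) simp
      have "a = prj a + c *\<^sub>R (u /\<^sub>R c)" using c by (simp add: u_def)
      also have "\<dots> \<in> span (e' ` {..<Suc n})"
        by (rule span_add[OF subsetD[OF BS prjB] span_scale[OF uS]])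
      finally have "a \<in> span (e' ` {..<Suc n})" .
      moreover have "B \<subseteq> span (e' ` {..<Suc n})" using span_superset[of B] BS by (rule order.trans)
      moreover have "e' ` {..<Suc n} \<subseteq> span (insert a B)"
      proof -
        have "e ` {..<n} \<subseteq> span (insert a B)"
          using span_superset[of "e ` {..<n}"] sub unfolding sp by (rule order.trans)
        moreover have "u /\<^sub>R c \<in> span (insert a B)" using u(1) by (rule span_scale)
        ultimately show ?thesis unfolding im by simp
      qed
      ultimately show ?thesis by (metis insert_subset span_eq)
    qed
    ultimately show ?thesis by blast
  qed
qed

text \<open>The form is nonnegative on the orthogonal complement of the frame, so the space is the orthogonal sum of
  a negative part and a nonnegative part.\<close>
locale split_frame = negative_frame +
  assumes orthogonal_nonneg: "(\<And>w. w \<in> N \<Longrightarrow> b w v = 0) \<Longrightarrow> b v v \<ge> 0"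
begin

lemma form_complement_nonneg: "b (v - prj v) (v - prj v) \<ge> 0"
  by (rule orthogonal_nonneg) (simp add: diff_right prj_orthogonal)

lemma form_split: "b v v = b (v - prj v) (v - prj v) + b (prj v) (prj v)"
proof -
  have "b (prj v) (v - prj v) = 0" by (simp add: diff_right prj_orthogonal[OF prj_in])
  then show ?thesis by (simp add: diff_left diff_right sym[of v "prj v"])
qed

definition neg_norm :: "'a \<Rightarrow> real" where "neg_norm v = sqrt (- b (prj v) (prj v))"
definition pos_norm :: "'a \<Rightarrow> real" where "pos_norm v = sqrt (b (v - prj v) (v - prj v))"

lemma form_norms: "b v v = (pos_norm v)\<^sup>2 - (neg_norm v)\<^sup>2"
  using form_split[of v] form_complement_nonneg[of v] form_nonpos[OF prj_in, of v]
  by (simp add: neg_norm_def pos_norm_def)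

lemma neg_norm_nonneg: "neg_norm v \<ge> 0" and pos_norm_nonneg: "pos_norm v \<ge> 0"
  using form_complement_nonneg[of v] form_nonpos[OF prj_in, of v]
  by (simp_all add: neg_norm_def pos_norm_def)

lemma neg_norm_triangle: "neg_norm (v + w) \<le> neg_norm v + neg_norm w"
proof -
  interpret p: bounded_linear prj by (rule bounded_linear_prj)
  have "bounded_bilinear (\<lambda>v w. b (prj v) (- prj w))"
    by (intro comp bounded_linear_prj bounded_linear_minus)
  from sqrt_semidefinite_triangle[OF this, of v w] show ?thesis
    using form_nonpos[OF prj_in] by (simp add: neg_norm_def minus_right sym)
qed

lemma pos_norm_triangle: "pos_norm (v + w) \<le> pos_norm v + pos_norm w"
proof -
  have "bounded_bilinear (\<lambda>v w. b (v - prj v) (w - prj w))"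
    by (intro comp bounded_linear_sub bounded_linear_ident bounded_linear_prj)
  from sqrt_semidefinite_triangle[OF this, of v w] show ?thesis
    using form_complement_nonneg by (simp add: pos_norm_def sym)
qed

lemma neg_norm_minus: "neg_norm (- v) = neg_norm v"
proof -
  interpret p: bounded_linear prj by (rule bounded_linear_prj)
  show ?thesis by (simp add: neg_norm_def p.neg minus_left minus_right)
qed

text \<open>
  The transversality that both existence and the decay estimate rest on. The vector \<open>w - w0\<close> has positive
  part at most \<open>\<kappa>\<close> times its negative part, while \<open>w - v0\<close> has positive part at least its negative part.
  Passing from one to the other costs only the two parts of \<open>w0 - v0\<close>, and \<open>\<kappa> < 1\<close> leaves a bound on the
  negative part of \<open>w - w0\<close>.
\<close>

lemma neg_norm_cone_bound:
  assumes "0 < \<kappa>" "\<kappa> < 1"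
    and cone: "b ((w - w0) - prj (w - w0)) ((w - w0) - prj (w - w0))
        + \<kappa>\<^sup>2 * b (prj (w - w0)) (prj (w - w0)) \<le> 0"
    and pos: "b (w - v0) (w - v0) \<ge> 0"
  shows "(1 - \<kappa>) * neg_norm (w - w0) \<le> neg_norm (w0 - v0) + pos_norm (w0 - v0)"
proof -
  have "(pos_norm (w - w0))\<^sup>2 \<le> (\<kappa> * neg_norm (w - w0))\<^sup>2"
    using cone form_complement_nonneg[of "w - w0"] form_nonpos[OF prj_in, of "w - w0"]
    by (simp add: pos_norm_def neg_norm_def power_mult_distrib)
  then have 1: "pos_norm (w - w0) \<le> \<kappa> * neg_norm (w - w0)"
    by (rule power2_le_imp_le) (use assms(1) neg_norm_nonneg in auto)
  have 2: "neg_norm (w - v0) \<le> pos_norm (w - v0)"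
    by (rule power2_le_imp_le) (use pos pos_norm_nonneg form_norms in auto)
  have 3: "pos_norm (w - v0) \<le> pos_norm (w - w0) + pos_norm (w0 - v0)"
    using pos_norm_triangle[of "w - w0" "w0 - v0"] by simp
  have 4: "neg_norm (w - w0) \<le> neg_norm (w - v0) + neg_norm (w0 - v0)"
    using neg_norm_triangle[of "w - v0" "v0 - w0"] neg_norm_minus[of "w0 - v0"] by simp
  show ?thesis using 1 2 3 4 by (simp add: algebra_simps)
qed

end

section \<open>Expanding maps between subspaces of equal dimension\<close>

text \<open>
  The image is closed, because a map that expands distances pulls Cauchy sequences back to Cauchy sequences.
  It is open by invariance of domain, applied in coordinates with respect to the two frames; there equality
  of the dimensions enters. The target is connected.
\<close>

lemma expanding_map_onto:
  fixes b :: "'e::banach \<Rightarrow> 'e \<Rightarrow> real" and b' :: "'f::real_normed_vector \<Rightarrow> 'f \<Rightarrow> real"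
  assumes "negative_frame b e n" "negative_frame b' e' n"
    and cont: "continuous_on (span (e ` {..<n})) G"
    and into: "\<And>x. x \<in> span (e ` {..<n}) \<Longrightarrow> G x \<in> span (e' ` {..<n})"
    and "c > 0"
    and expand: "\<And>x y. x \<in> span (e ` {..<n}) \<Longrightarrow> y \<in> span (e ` {..<n}) \<Longrightarrow>
      c * dist x y \<le> dist (G x) (G y)"
  shows "G ` span (e ` {..<n}) = span (e' ` {..<n})"
proof -
  interpret A: negative_frame b e n by fact
  interpret B: negative_frame b' e' n by fact
  define T where "T = {x::nat \<Rightarrow> real. \<forall>i\<ge>n. x i = 0}"
  have Eu: "Euclidean_space n = top_of_set T"
    by (simp add: Euclidean_space_def T_def euclidean_product_topology)
  define comb where "comb x = (\<Sum>i<n. x i *\<^sub>R e i)" for x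
  define crd where "crd v = (\<lambda>i. if i < n then - b (e i) v else 0)" for v
  define crd' where "crd' v = (\<lambda>i. if i < n then - b' (e' i) v else 0)" for v
  have comb_in: "comb x \<in> A.N" for x unfolding comb_def by (rule A.sum_frame_in)
  have comb_crd: "comb (crd v) = v" if "v \<in> A.N" for v
    using A.prj_id[OF that] by (simp add: comb_def crd_def A.prj_def)
  have crd_comb: "crd (comb x) = x" if "x \<in> T" for x
    using that by (auto simp: crd_def comb_def A.coordinate_sum T_def)
  have crd'_inj: "v = w" if "crd' v = crd' w" "v \<in> B.N" "w \<in> B.N" for v w
  proof -
    have "b' (e' i) v = b' (e' i) w" if "i < n" for i
      using fun_cong[OF \<open>crd' v = crd' w\<close>, of i] that by (simp add: crd'_def)
    then have "B.prj v = B.prj w" by (simp add: B.prj_def)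
    then show ?thesis using that by (simp add: B.prj_id)
  qed
  have crd'_cont: "continuous_on UNIV crd'"
    unfolding crd'_def
  proof (rule continuous_on_coordinatewise_then_product)
    show "continuous_on UNIV (\<lambda>v. if i < n then - b' (e' i) v else 0)" for i
      by (cases "i < n") (auto intro!: continuous_intros B.continuous_on)
  qed
  have comb_cont: "continuous_on T comb"
    unfolding comb_def
    by (intro continuous_intros continuous_on_subset[OF continuous_on_product_coordinates]) auto
  define f where "f = crd' \<circ> G \<circ> comb"
  have "continuous_on T (G \<circ> comb)"
    using comb_in by (intro continuous_on_compose comb_cont continuous_on_subset[OF cont]) auto
  then have "continuous_on T f"
    unfolding f_def comp_assoc
    by (rule continuous_on_compose) (rule continuous_on_subset[OF crd'_cont], simp)
  moreover have "f ` T \<subseteq> T" by (auto simp: f_def crd'_def T_def)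
  ultimately have f_map: "continuous_map (Euclidean_space n) (Euclidean_space n) f"
    by (auto simp: Eu)
  have "inj_on f T"
  proof (rule inj_onI)
    fix x y assume xy: "x \<in> T" "y \<in> T" "f x = f y"
    then have "G (comb x) = G (comb y)"
      by (intro crd'_inj into comb_in) (simp_all add: f_def)
    then have "comb x = comb y"
      using expand[OF comb_in comb_in, of x y] \<open>c > 0\<close> by (simp add: mult_le_0_iff)
    then show "x = y" using crd_comb xy by metis
  qed
  then have "openin (Euclidean_space n) (f ` T)"
    using f_map by (intro invariance_of_domain_Euclidean_space) (simp_all add: Eu subtopology_subtopology)
  then obtain W where W: "open W" "f ` T = T \<inter> W"
    by (auto simp: Eu openin_open)
  let ?H = "G ` A.N"
  have H: "?H = B.N \<inter> crd' -` W"
  proof (intro equalityI subsetI)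
    fix y assume "y \<in> ?H"
    then obtain x where x: "x \<in> A.N" "y = G x" by auto
    have "crd x \<in> T" by (auto simp: crd_def T_def)
    moreover have "f (crd x) = crd' y" using x comb_crd by (simp add: f_def)
    ultimately have "crd' y \<in> f ` T" by (metis imageI)
    then have "crd' y \<in> W" using W by auto
    then show "y \<in> B.N \<inter> crd' -` W" using x into by auto
  next
    fix y assume y: "y \<in> B.N \<inter> crd' -` W"
    moreover have "crd' y \<in> T" by (auto simp: crd'_def T_def)
    ultimately have "crd' y \<in> f ` T" using W by auto
    then obtain z where "crd' y = crd' (G (comb z))" by (auto simp: f_def)
    then have "y = G (comb z)" using y into comb_in by (intro crd'_inj) auto
    then show "y \<in> ?H" using comb_in by auto
  qed
  have "openin (top_of_set B.N) ?H"
    unfolding H using open_vimage[OF W(1) crd'_cont] by (rule openin_open_Int)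
  moreover have "closed ?H"
    unfolding closed_sequential_limits
  proof (intro allI impI, elim conjE)
    fix y l assume y: "\<forall>k. y k \<in> ?H" and l: "y \<longlonglongrightarrow> l"
    have "\<exists>x. x \<in> A.N \<and> y k = G x" for k using y by blast
    then obtain x where x: "\<And>k. x k \<in> A.N" "\<And>k. y k = G (x k)"
      by metis
    have "Cauchy y" using l by (rule LIMSEQ_imp_Cauchy)
    have "Cauchy x"
    proof (rule metric_CauchyI)
      fix \<epsilon> :: real assume "\<epsilon> > 0"
      then obtain K where K: "\<And>m k. m \<ge> K \<Longrightarrow> k \<ge> K \<Longrightarrow> dist (y m) (y k) < c * \<epsilon>"
        using metric_CauchyD[OF \<open>Cauchy y\<close>, of "c * \<epsilon>"] \<open>c > 0\<close> by auto
      have "dist (x m) (x k) < \<epsilon>" if "m \<ge> K" "k \<ge> K" for m k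
      proof -
        have "c * dist (x m) (x k) < c * \<epsilon>"
          using expand[OF x(1) x(1), of m k] K[OF that] by (simp add: x(2))
        then show ?thesis using \<open>c > 0\<close> by simp
      qed
      then show "\<exists>K. \<forall>m\<ge>K. \<forall>k\<ge>K. dist (x m) (x k) < \<epsilon>" by blast
    qed
    then obtain \<xi> where \<xi>: "x \<longlonglongrightarrow> \<xi>" by (auto simp: Cauchy_convergent_iff convergent_def)
    then have \<xi>N: "\<xi> \<in> A.N" using A.closed_frame x(1) by (auto simp: closed_sequential_limits)
    have "(\<lambda>k. G (x k)) \<longlonglongrightarrow> G \<xi>"
      by (rule continuous_on_tendsto_compose[OF cont \<xi> \<xi>N]) (simp add: x(1))
    then have "y \<longlonglongrightarrow> G \<xi>" by (simp only: x(2)[symmetric])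
    then have "l = G \<xi>" using l by (rule LIMSEQ_unique[rotated])
    then show "l \<in> ?H" using \<xi>N by simp
  qed
  then have "closedin (top_of_set B.N) ?H"
    using into by (intro closed_subset) auto
  moreover have "connected B.N"
    by (intro convex_connected subspace_imp_convex) simp
  moreover have "?H \<noteq> {}" using span_zero by auto
  ultimately show ?thesis by (auto simp: connected_clopen)
qed

text \<open>
  The subspace is closed under multiplication by scalars. Testing with the multiple of \<open>w\<close> by the value of
  the pairing itself turns the vanishing real part into the vanishing squared modulus.
\<close>

lemma orthogonal_pairing_zero:
  fixes A :: "('e::real_normed_vector, 'k::real_or_complex) form_operator"
  assumes "normed_space_over sc" "symmetric_operator sc A" "module.subspace sc N"
    and zero: "\<And>w. w \<in> N \<Longrightarrow> rform A w v = 0" and "w \<in> N"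
  shows "pairing w (blinfun_apply A v) = 0"
proof -
  interpret normed_space_over sc by fact
  note S = assms(2)[unfolded symmetric_operator_def]
  define p where "p = pairing w (blinfun_apply A v)"
  have p': "pairing v (blinfun_apply A w) = sconj p" using S unfolding p_def by blast
  have "sc p w \<in> N" using assms(3) \<open>w \<in> N\<close> by (simp add: subspace_scale)
  then have "0 = (2 * rform A (sc p w) v) *\<^sub>R (1::'k)" by (simp add: zero)
  also have "\<dots> = pairing (sc p w) (blinfun_apply A v) + pairing v (blinfun_apply A (sc p w))"
    by (rule rform_eq[OF assms(2)])
  also have "pairing (sc p w) (blinfun_apply A v) = sconj p * p"
    unfolding p_def using S by blast
  also have "pairing v (blinfun_apply A (sc p w)) = p * sconj p"
    unfolding p'[symmetric] using S by blast
  also have "sconj p * p + p * sconj p = (2 * (norm p)\<^sup>2) *\<^sub>R 1" using mult_sconj[of p]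
    by (simp add: mult.commute flip: scaleR_2)
  finally show ?thesis by (simp add: p_def)
qed

text \<open>
  The coordinate projection satisfies the defining conditions. Conversely these conditions fix all
  coordinates of the projected vector.
\<close>

lemma projector_eq_prj:
  fixes A :: "('e::real_normed_vector, 'k::real_or_complex) form_operator"
  assumes "normed_space_over sc" "symmetric_operator sc A" "module.subspace sc N"
    and "negative_frame (rform A) e n" and N: "span (e ` {..<n}) = N"
  shows "blinfun_apply (projector A N) = negative_frame.prj (rform A) e n"
proof -
  interpret negative_frame "rform A" e n by fact
  have diff: "pairing w (blinfun_apply A (v - u)) = pairing w (blinfun_apply A v) - pairing w (blinfun_apply A u)" for w v u
    by (simp add: pairing_def blinfun.diff_right blinfun.diff_left)
  define P where "P = Blinfun prj"
  have P: "blinfun_apply P = prj" unfolding P_def by (rule bounded_linear_Blinfun_apply[OF bounded_linear_prj])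
  have "projector A N = P"
    unfolding projector_def
  proof (rule the_equality, intro conjI allI ballI)
    show "blinfun_apply P v \<in> N" for v using prj_in N by (simp add: P)
    show "pairing w (blinfun_apply A v) = pairing w (blinfun_apply A (blinfun_apply P v))" if "w \<in> N" for v w
    proof -
      have "pairing w (blinfun_apply A (v - prj v)) = 0"
        by (rule orthogonal_pairing_zero[OF assms(1-3) _ that]) (use N prj_orthogonal in \<open>simp add: diff_right\<close>)
      then show ?thesis by (simp add: P diff)
    qed
  next
    fix P' assume P': "(\<forall>v. blinfun_apply P' v \<in> N) \<and>
      (\<forall>v. \<forall>w\<in>N. pairing w (blinfun_apply A v) = pairing w (blinfun_apply A (blinfun_apply P' v)))"
    show "P' = P"
    proof (rule blinfun_eqI)
      fix v
      let ?u = "blinfun_apply P' v"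
      have "rform A w v = rform A w ?u" if "w \<in> N" for w
        unfolding rform_def using P'[THEN conjunct2, rule_format, OF that, of v] by (rule arg_cong)
      then have "rform A (e i) v = rform A (e i) ?u" if "i < n" for i
        using that N span_base[of "e i" "e ` {..<n}"] by auto
      then have "prj v = prj ?u" by (simp add: prj_def)
      also have "prj ?u = ?u" by (rule prj_id) (use P'[THEN conjunct1, rule_format, of v] N in simp)
      finally show "?u = blinfun_apply P v" by (simp only: P)
    qed
  qed
  then show ?thesis by (simp add: P)
qed

text \<open>
  By homogeneity this is the definition of the infimum, as soon as the infimum is a positive real. It is
  positive because the norm is bounded by a multiple of \<open>sqrt (- qform A)\<close> on the span of a finite frame, and finite
  as soon as there is a nonzero vector.
\<close>

lemma norm_le_C_inv:
  fixes A :: "('e::real_normed_vector, 'k::real_or_complex) form_operator"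
  assumes "negative_frame (rform A) e n" "v \<in> span (e ` {..<n})"
  shows "norm v \<le> C_inv A (span (e ` {..<n})) * sqrt (- qform A v)"
proof (cases "v = 0")
  case True
  interpret negative_frame "rform A" e n by fact
  show ?thesis using True by (simp add: qform_rform zero_left)
next
  case False
  interpret negative_frame "rform A" e n by fact
  let ?C = "C_const A N"
  define K where "K = (\<Sum>i<n. norm (e i)) + 1"
  have K: "K > 0" unfolding K_def by (intro add_nonneg_pos sum_nonneg) auto
  have low: "ereal (1 / K) \<le> ?C"
    unfolding C_const_def
  proof (intro INF_greatest)
    fix \<zeta> assume \<zeta>: "\<zeta> \<in> {\<zeta> \<in> N. norm \<zeta> = 1}"
    have "1 \<le> (\<Sum>i<n. norm (e i)) * sqrt (- qform A \<zeta>)"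
      using norm_le_form[of \<zeta>] \<zeta> by (simp add: qform_rform)
    also have "\<dots> \<le> K * sqrt (- qform A \<zeta>)"
      using form_nonpos[of \<zeta>] \<zeta> by (intro mult_right_mono) (auto simp: K_def qform_rform)
    finally show "ereal (1 / K) \<le> ereal (sqrt (- qform A \<zeta>))"
      using K by (simp add: divide_le_eq mult.commute)
  qed
  define u where "u = v /\<^sub>R norm v"
  have "u \<in> {\<zeta> \<in> N. norm \<zeta> = 1}" using assms(2) False by (auto simp: u_def span_scale)
  then have up: "?C \<le> ereal (sqrt (- qform A u))" unfolding C_const_def by (rule INF_lower)
  obtain c where c: "?C = ereal c" using low up by (cases ?C) auto
  have "1 / K \<le> c" using low c by simp
  then have c_pos: "c > 0" by (rule less_le_trans[rotated]) (simp add: K)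
  have "- qform A u = - qform A v / (norm v)\<^sup>2"
    by (simp add: u_def qform_rform scaleR_left scaleR_right power2_eq_square divide_inverse mult_ac)
  then have "sqrt (- qform A u) = sqrt (- qform A v) / norm v"
    by (simp only: real_sqrt_divide real_sqrt_abs abs_norm_cancel)
  then have "c \<le> sqrt (- qform A v) / norm v" using up c by simp
  then have "norm v \<le> 1 / c * sqrt (- qform A v)"
    using c_pos False by (simp add: field_simps)
  then show ?thesis using c c_pos by (simp add: C_inv_def divide_inverse)
qed

lemma C_inv_nonneg:
  fixes A :: "('e::real_normed_vector, 'k::real_or_complex) form_operator"
  assumes "negative_frame (rform A) e n"
  shows "C_inv A (span (e ` {..<n})) \<ge> 0"
proof -
  interpret negative_frame "rform A" e n by fact
  have "0 \<le> C_const A N"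
    unfolding C_const_def
    by (intro INF_greatest) (auto simp: qform_rform form_nonpos)
  then show ?thesis unfolding C_inv_def by (simp add: real_of_ereal_pos)
qed

text \<open>
  Gram-Schmidt gives a frame over each base point. The complement in the definition of a quadratic family
  need not be orthogonal to the negative subspace. But a vector \<open>v\<close> orthogonal to that subspace is the sum of
  some \<open>x\<close> in the complement and some \<open>y\<close> in the subspace, and then \<open>V v = V x - V y \<ge> 0\<close>.
\<close>

lemma quadratic_family_frames:
  assumes "normed_space_over sc" "quadratic_family sc j Q Em"
  shows "\<exists>n e. \<forall>q. split_frame (rform (Q q)) (e q) n \<and> span (e q ` {..<n}) = Em q"
proof -
  interpret normed_space_over sc by fact
  note Q = assms(2)[unfolded quadratic_family_def, THEN conjunct1, rule_format]
  have ex: "\<exists>e n. split_frame (rform (Q q)) e n \<and> Real_Vector_Spaces.span (e ` {..<n}) = Em q" for q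
  proof -
    note sym = Q[of q, THEN conjunct1]
      and dim = Q[of q, THEN conjunct2, THEN conjunct1]
      and neg = Q[of q, THEN conjunct2, THEN conjunct2, THEN conjunct1]
    obtain F where F: "{x + y | x y. x \<in> F \<and> y \<in> Em q} = UNIV"
      "\<forall>v\<in>F. v \<noteq> 0 \<longrightarrow> qform (Q q) v > 0" using Q[of q] by (elim conjE exE) (rule that)
    obtain D where D: "finite D" "Real_Vector_Spaces.span D = Em q"
      using finite_real_span_of_subspace_of_dim[OF assms(1) dim] by blast
    have negD: "rform (Q q) v v < 0" if "v \<in> Real_Vector_Spaces.span D" "v \<noteq> 0" for v
      using neg that D(2) by (simp add: qform_rform)
    obtain e n where e: "negative_frame (rform (Q q)) e n" "Real_Vector_Spaces.span (e ` {..<n}) = Em q"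
      using gram_schmidt[OF bounded_bilinear_rform[OF sym] rform_sym[OF sym] D(1) negD]
      unfolding D(2) by blast
    interpret f: negative_frame "rform (Q q)" e n by fact
    have "split_frame (rform (Q q)) e n"
    proof
      fix v assume orth: "\<And>w. w \<in> f.N \<Longrightarrow> rform (Q q) w v = 0"
      obtain x y where xy: "v = x + y" "x \<in> F" "y \<in> Em q" using F(1) by blast
      have "rform (Q q) y v = 0" "rform (Q q) v y = 0"
        using orth[of y] xy(3) e(2) f.sym[of v y] by simp_all
      then have "rform (Q q) x x = rform (Q q) v v + rform (Q q) y y"
        unfolding xy(1) by (simp add: f.add_left f.add_right)
      moreover have "rform (Q q) x x \<ge> 0"
        using F(2) xy(2) by (cases "x = 0") (auto simp: qform_rform f.zero_left less_imp_le)
      moreover have "rform (Q q) y y \<le> 0" using f.form_nonpos xy(3) e(2) by simp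
      ultimately show "0 \<le> rform (Q q) v v" by simp
    qed
    then show ?thesis using e by blast
  qed
  from choice[OF allI, OF ex] obtain e where
    "\<forall>q. \<exists>n. split_frame (rform (Q q)) (e q) n \<and> Real_Vector_Spaces.span (e q ` {..<n}) = Em q" ..
  from choice[OF this] obtain m where
    m: "\<forall>q. split_frame (rform (Q q)) (e q) (m q) \<and> Real_Vector_Spaces.span (e q ` {..<m q}) = Em q" ..
  note em = m[THEN spec, THEN conjunct1] m[THEN spec, THEN conjunct2]
  have same: "m q = m q'" for q q'
  proof -
    obtain f where f: "linear f" "inj_on f (Em q)" "f ` Em q = Em q'"
      using subspace_of_dim_real_isomorphism[OF assms(1)
          Q[of q, THEN conjunct2, THEN conjunct1] Q[of q', THEN conjunct2, THEN conjunct1]] by blast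
    have "m q = Real_Vector_Spaces.dim (Em q)" for q
      using negative_frame.dim_frame[OF split_frame.axioms(1)[OF em(1)], of q] em(2) by simp
    moreover have "Real_Vector_Spaces.dim (Em q) = Real_Vector_Spaces.dim (Em q')"
    proof -
      define C where "C = e q ` {..<m q}"
      interpret C: split_frame "rform (Q q)" "e q" "m q" by (rule em(1))
      have C: "Real_Vector_Spaces.independent C" "Real_Vector_Spaces.span C = Em q"
        using C.independent_frame em(2) by (simp_all add: C_def)
      have "Real_Vector_Spaces.independent (f ` C)"
        using f(1,2) C by (intro linear_independent_injective_image) simp_all
      moreover have "Real_Vector_Spaces.span (f ` C) = Em q'"
        using linear_span_image[OF f(1), of C] C f by simp
      moreover have "card (f ` C) = card C"
        using f(2) C(2) Real_Vector_Spaces.span_superset[of C] by (intro card_image) (auto intro: inj_on_subset)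
      ultimately show ?thesis
        using C by (metis Real_Vector_Spaces.dim_span_eq_card_independent)
    qed
    ultimately show ?thesis by simp
  qed
  show ?thesis
  proof (intro exI[of _ "m undefined"] exI[of _ e] allI)
    fix q
    show "split_frame (rform (Q q)) (e q) (m undefined)
        \<and> Real_Vector_Spaces.span (e q ` {..<m undefined}) = Em q"
      using m[THEN spec, of q] same[of q undefined] by simp
  qed
qed

section \<open>Integrals along orbits\<close>

lemma set_integral_increment:
  fixes g :: "real \<Rightarrow> real"
  assumes int: "set_integrable lborel {0..t} g" and st: "0 \<le> s" "s \<le> t"
    and low: "\<And>x. x \<in> {s<..t} \<Longrightarrow> m \<le> g x"
  shows "m * (t - s) \<le> (LBINT x:{0..t}. g x) - (LBINT x:{0..s}. g x)"
proof -
  have int1: "set_integrable lborel {0..s} g" and int2: "set_integrable lborel {s<..t} g"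
    using st by (auto intro!: set_integrable_subset[OF int])
  have "{0..t} = {0..s} \<union> {s<..t}" using st by auto
  moreover have "{0..s} \<inter> {s<..t} = {}" by auto
  ultimately have "(LBINT x:{0..t}. g x) = (LBINT x:{0..s}. g x) + (LBINT x:{s<..t}. g x)"
    using set_integral_Un[OF _ int1 int2] by presburger
  moreover have "m * (t - s) \<le> (LBINT x:{s<..t}. g x)"
  proof -
    have "m * (t - s) = (LBINT x:{s<..t}. m)"
      using st by (simp add: set_lebesgue_integral_def)
    also have "\<dots> \<le> (LBINT x:{s<..t}. g x)"
    proof (intro set_integral_mono int2 low)
      have "set_integrable lborel {s..t} (\<lambda>_. m)"
        by (intro borel_integrable_atLeastAtMost' continuous_on_const)
      then show "set_integrable lborel {s<..t} (\<lambda>_. m)"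
        by (rule set_integrable_subset) auto
    qed
    finally show ?thesis .
  qed
  ultimately show ?thesis by simp
qed

lemma set_integral_point: "(LBINT x:{c..c::real}. f x) = (0::real)"
  unfolding set_lebesgue_integral_def
proof (rule integral_eq_zero_AE)
  show "AE x in lborel. indicator {c..c} x *\<^sub>R f x = 0"
    using AE_lborel_singleton[of c] by eventually_elim simp
qed

lemma rate_integral_0: "rate_integral \<theta> a 0 q = 0"
  unfolding rate_integral_def by (rule set_integral_point)

text \<open>
  The integrand is a Borel function of the continuous orbit, and it is bounded.
\<close>

lemma rate_integrable:
  assumes "semiflow \<theta>" "bounded_rate a"
  shows "set_integrable lborel {0..t} (\<lambda>s. a (\<theta> s q))"
proof -
  obtain a1 a2 where a: "a \<in> borel_measurable borel" "\<And>q. a q \<in> {a1..a2}"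
    using assms(2) unfolding bounded_rate_def by blast
  have c: "continuous_on ({0..} \<times> UNIV) (\<lambda>(t, q). \<theta> t q)" using assms(1) by (simp add: semiflow_def)
  have "continuous_on {0..t} (\<lambda>s. (\<lambda>(t, q). \<theta> t q) (s, q))"
    by (rule continuous_on_compose2[OF c]) (auto intro!: continuous_intros)
  then have "(\<lambda>s. \<theta> s q) \<in> borel_measurable (restrict_space borel {0..t})"
    by (intro borel_measurable_continuous_on_restrict) simp
  from measurable_compose[OF this a(1)]
  have "(\<lambda>s. a (\<theta> s q)) \<in> borel_measurable (restrict_space borel {0..t})" .
  then have meas: "set_borel_measurable lborel {0..t} (\<lambda>s. a (\<theta> s q))"
    by (simp add: set_borel_measurable_def borel_measurable_restrict_space_iff)
  have int: "set_integrable lborel {0..t} (\<lambda>s. max \<bar>a1\<bar> \<bar>a2\<bar>)"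
    by (intro borel_integrable_atLeastAtMost' continuous_on_const)
  have "\<bar>a x\<bar> \<le> max \<bar>a1\<bar> \<bar>a2\<bar>" for x using a(2)[of x] by auto
  then show ?thesis by (intro set_integrable_bound[OF int meas]) simp
qed

lemma rate_integral_increment:
  assumes "semiflow \<theta>" "bounded_rate a"
  obtains c where "c \<ge> 0"
    "\<And>q s t. 0 \<le> s \<Longrightarrow> s \<le> t \<Longrightarrow> \<bar>rate_integral \<theta> a t q - rate_integral \<theta> a s q\<bar> \<le> c * (t - s)"
proof -
  obtain a1 a2 where a: "\<And>q. a q \<in> {a1..a2}"
    using assms(2) unfolding bounded_rate_def by blast
  define c where "c = max \<bar>a1\<bar> \<bar>a2\<bar>"
  have ac: "- c \<le> a q" "- c \<le> - a q" for q using a[of q] by (auto simp: c_def)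
  have "\<bar>rate_integral \<theta> a t q - rate_integral \<theta> a s q\<bar> \<le> c * (t - s)" if "0 \<le> s" "s \<le> t" for q s t
  proof -
    note int = rate_integrable[OF assms, of t q]
    have "- c * (t - s) \<le> rate_integral \<theta> a t q - rate_integral \<theta> a s q"
      unfolding rate_integral_def by (rule set_integral_increment[OF int that ac(1)])
    moreover have "- c * (t - s) \<le> (LBINT x:{0..t}. - a (\<theta> x q)) - (LBINT x:{0..s}. - a (\<theta> x q))"
      by (rule set_integral_increment[OF _ that ac(2)]) (use int in \<open>simp add: set_integrable_def\<close>)
    then have "- c * (t - s) \<le> - (rate_integral \<theta> a t q - rate_integral \<theta> a s q)"
      by (simp add: rate_integral_def set_lebesgue_integral_def)
    ultimately show ?thesis by (simp add: abs_le_iff)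
  qed
  moreover have "c \<ge> 0" by (simp add: c_def)
  ultimately show ?thesis using that by blast
qed

lemma continuous_on_rate_integral:
  assumes "semiflow \<theta>" "bounded_rate a"
  shows "continuous_on {0..} (\<lambda>t. rate_integral \<theta> a t q)"
proof -
  obtain c where c: "c \<ge> 0"
    "\<And>q s t. 0 \<le> s \<Longrightarrow> s \<le> t \<Longrightarrow> \<bar>rate_integral \<theta> a t q - rate_integral \<theta> a s q\<bar> \<le> c * (t - s)"
    using rate_integral_increment[OF assms] by blast
  have "c-lipschitz_on {0..} (\<lambda>t. rate_integral \<theta> a t q)"
  proof (rule lipschitz_onI[OF _ c(1)])
    fix s t :: real assume st: "s \<in> {0..}" "t \<in> {0..}"
    show "dist (rate_integral \<theta> a s q) (rate_integral \<theta> a t q) \<le> c * dist s t"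
    proof (cases "s \<le> t")
      case True
      then show ?thesis using c(2)[of s t q] st by (simp add: dist_real_def)
    next
      case False
      then show ?thesis using c(2)[of t s q] st by (simp add: dist_real_def)
    qed
  qed
  then show ?thesis by (rule lipschitz_on_continuous_on)
qed

text \<open>
  Such a function converges to its supremum, so increments over intervals of fixed length vanish at
  infinity.
\<close>

lemma bounded_mono_increment_tendsto_0:
  fixes J :: "real \<Rightarrow> real"
  assumes mono: "mono_on {0..} J" and bound: "\<And>t. t \<ge> 0 \<Longrightarrow> J t \<le> B"
  shows "((\<lambda>t. J (t - a) - J (t - a - 1)) \<longlongrightarrow> 0) at_top"
proof (rule tendstoI)
  fix \<epsilon> :: real assume "\<epsilon> > 0"
  define S where "S = (SUP t\<in>{0..}. J t)"
  have bdd: "bdd_above (J ` {0..})" using bound by (auto simp: bdd_above_def)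
  have "S - \<epsilon> < (SUP t\<in>{0..}. J t)" using \<open>\<epsilon> > 0\<close> by (simp add: S_def)
  moreover have "(S - \<epsilon> < (SUP t\<in>{0..}. J t)) = (\<exists>s\<in>{0..}. S - \<epsilon> < J s)"
    by (rule less_cSUP_iff[OF _ bdd]) simp
  ultimately obtain s where s: "s \<ge> 0" "S - \<epsilon> < J s" by auto
  have "dist (J (t - a) - J (t - a - 1)) 0 < \<epsilon>" if "t \<ge> s + \<bar>a\<bar> + 1" for t
  proof -
    have "J s \<le> J (t - a - 1)" "J (t - a - 1) \<le> J (t - a)"
      using that s by (auto intro!: mono_onD[OF mono])
    moreover have "J (t - a) \<le> S"
      unfolding S_def using that s by (intro cSUP_upper bdd) auto
    ultimately show ?thesis using s by (simp add: dist_real_def)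
  qed
  then show "\<forall>\<^sub>F t in at_top. dist (J (t - a) - J (t - a - 1)) 0 < \<epsilon>"
    unfolding eventually_at_top_linorder by blast
qed

section \<open>Semicocycles with both squeezing properties\<close>

text \<open>The hypotheses on the forms enter through orthonormal frames of the negative subspaces, all of the same
  length \<open>n\<close>, and uniform bounds \<open>K\<close> for the forms and \<open>p\<close> for the projectors.\<close>
locale squeezed_semicocycle =
  fixes \<theta> :: "real \<Rightarrow> 'q::metric_space \<Rightarrow> 'q"
    and \<psi> :: "real \<Rightarrow> 'q \<Rightarrow> 'e::banach \<Rightarrow> 'e"
    and Q :: "'q \<Rightarrow> ('e, 'k::real_or_complex) form_operator"
    and Em :: "'q \<Rightarrow> 'e set"
    and \<iota> :: "'e \<Rightarrow> 'h::real_normed_vector"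
    and \<alpha>0 \<beta>0 :: "'q \<Rightarrow> real"
    and \<delta> \<tau> :: real
    and e :: "'q \<Rightarrow> nat \<Rightarrow> 'e" and n :: nat and K p :: real
  assumes semiflow: "semiflow \<theta>" and semicocycle: "semicocycle \<theta> \<psi>"
    and embedding: "bounded_linear \<iota>"
    and \<delta>_pos: "\<delta> > 0" and \<tau>_nonneg: "\<tau> \<ge> 0"
    and negative_squeezing: "negative_squeezing \<theta> \<psi> Q \<iota> \<alpha>0 \<delta> \<tau>"
    and positive_squeezing: "positive_squeezing \<theta> \<psi> Q \<iota> \<beta>0 \<delta> \<tau>"
    and uniformly_Lipschitz: "uniformly_Lipschitz \<psi> \<iota>"
    and frame: "split_frame (rform (Q q)) (e q) n"
    and span_frame: "span (e q ` {..<n}) = Em q"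
    and projector_frame: "blinfun_apply (projector (Q q) (Em q)) = negative_frame.prj (rform (Q q)) (e q) n"
    and form_bound: "\<bar>rform (Q q) v w\<bar> \<le> K * norm v * norm w"
    and projector_bound: "norm (projector (Q q) (Em q)) \<le> p"
    and K_pos: "K > 0" and p_nonneg: "p \<ge> 0"
begin

sublocale fr: split_frame "rform (Q q)" "e q" n for q
  by (rule frame)

abbreviation "V q v \<equiv> qform (Q q) v"
abbreviation "\<pi> q \<equiv> blinfun_apply (projector (Q q) (Em q))"
abbreviation "\<alpha> t q \<equiv> rate_integral \<theta> \<alpha>0 t q"
abbreviation "\<beta> t q \<equiv> rate_integral \<theta> \<beta>0 t q"

lemma flow_0: "\<theta> 0 q = q" and flow_add: "t \<ge> 0 \<Longrightarrow> s \<ge> 0 \<Longrightarrow> \<theta> (t + s) q = \<theta> t (\<theta> s q)"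
  using semiflow by (auto simp: semiflow_def)

lemma cocycle_0: "\<psi> 0 q v = v"
  and cocycle_add: "t \<ge> 0 \<Longrightarrow> s \<ge> 0 \<Longrightarrow> \<psi> (t + s) q v = \<psi> t (\<theta> s q) (\<psi> s q v)"
  and cocycle_continuous: "continuous_on ({0..} \<times> UNIV) (\<lambda>(t, q, v). \<psi> t q v)"
  using semicocycle by (auto simp: semicocycle_def)

lemma continuous_time: "continuous_on {0..} (\<lambda>t. \<psi> t q v)"
proof -
  have "continuous_on {0..} (\<lambda>t. (\<lambda>(t, q, v). \<psi> t q v) (t, q, v))"
    by (rule continuous_on_compose2[OF cocycle_continuous]) (auto intro!: continuous_intros)
  then show ?thesis by simp
qed

lemma continuous_state: "t \<ge> 0 \<Longrightarrow> continuous_on S (\<lambda>v. \<psi> t q v)"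
proof -
  assume "t \<ge> 0"
  then have "continuous_on S (\<lambda>v. (\<lambda>(t, q, v). \<psi> t q v) (t, q, v))"
    by (intro continuous_on_compose2[OF cocycle_continuous]) (auto intro!: continuous_intros)
  then show ?thesis by simp
qed

lemma V_form: "V q v = rform (Q q) v v"
  by (rule qform_rform)

lemma V_abs_le: "\<bar>V q v\<bar> \<le> K * (norm v)\<^sup>2"
  using form_bound[of q v v] by (simp add: V_form power2_eq_square mult.assoc)

lemma V_tendsto: "(f \<longlongrightarrow> l) F \<Longrightarrow> ((\<lambda>x. V q (f x)) \<longlongrightarrow> V q l) F"
  unfolding V_form by (rule fr.tendsto)

lemma \<pi>_prj: "\<pi> q = fr.prj q"
  by (rule projector_frame)

lemma \<pi>_in: "\<pi> q v \<in> Em q"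
  using fr.prj_in[of q v] by (simp only: \<pi>_prj span_frame)

lemma \<pi>_norm_le: "norm (\<pi> q v) \<le> p * norm v"
  using norm_blinfun[of "projector (Q q) (Em q)" v] mult_right_mono[OF projector_bound[of q], of "norm v"] by simp

lemma neg_norm_\<pi>: "fr.neg_norm q v \<le> sqrt K * norm (\<pi> q v)"
proof -
  have "- rform (Q q) (\<pi> q v) (\<pi> q v) \<le> K * (norm (\<pi> q v))\<^sup>2"
    using V_abs_le[of q "\<pi> q v"] by (simp add: V_form)
  then have "sqrt (- rform (Q q) (\<pi> q v) (\<pi> q v)) \<le> sqrt (K * (norm (\<pi> q v))\<^sup>2)"
    by (rule real_sqrt_le_mono)
  then show ?thesis by (simp add: fr.neg_norm_def \<pi>_prj real_sqrt_mult)
qed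

lemma neg_norm_le: "fr.neg_norm q v \<le> sqrt K * p * norm v"
proof -
  have "sqrt K * norm (\<pi> q v) \<le> sqrt K * (p * norm v)"
    using K_pos by (intro mult_left_mono \<pi>_norm_le) auto
  then show ?thesis using neg_norm_\<pi>[of q v] by simp
qed

lemma pos_norm_le: "fr.pos_norm q v \<le> sqrt K * (1 + p) * norm v"
proof -
  let ?u = "v - \<pi> q v"
  have "rform (Q q) ?u ?u \<le> K * (norm ?u)\<^sup>2"
    using V_abs_le[of q ?u] by (simp add: V_form)
  then have "sqrt (rform (Q q) ?u ?u) \<le> sqrt (K * (norm ?u)\<^sup>2)"
    by (rule real_sqrt_le_mono)
  then have "fr.pos_norm q v \<le> sqrt K * norm ?u"
    by (simp add: fr.pos_norm_def \<pi>_prj real_sqrt_mult)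
  also have "\<dots> \<le> sqrt K * ((1 + p) * norm v)"
    using K_pos norm_triangle_ineq4[of v "\<pi> q v"] \<pi>_norm_le[of q v]
    by (intro mult_left_mono) (auto simp: algebra_simps)
  finally show ?thesis by simp
qed

lemma norm_\<pi>_le: "norm (\<pi> q v) \<le> C_inv (Q q) (Em q) * fr.neg_norm q v"
  using norm_le_C_inv[OF fr.negative_frame_axioms fr.prj_in, of q v]
  by (simp add: span_frame \<pi>_prj fr.neg_norm_def V_form)

lemma C_inv_Em_nonneg: "C_inv (Q q) (Em q) \<ge> 0"
  using C_inv_nonneg[OF fr.negative_frame_axioms, of q] by (simp add: span_frame)

lemma qform_kappa_eq:
  "qform_kappa \<kappa> (Q q) (Em q) v = (fr.pos_norm q v)\<^sup>2 - \<kappa>\<^sup>2 * (fr.neg_norm q v)\<^sup>2"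
  using fr.form_complement_nonneg[of q v] fr.form_nonpos[OF fr.prj_in, of q v]
  by (simp add: qform_kappa_def Let_def V_form \<pi>_prj fr.pos_norm_def fr.neg_norm_def)

lemma neg_norm_cone_bound:
  assumes "0 < \<kappa>" "\<kappa> < 1" "qform_kappa \<kappa> (Q q) (Em q) (w - w0) \<le> 0" "V q (w - v0) \<ge> 0"
  shows "(1 - \<kappa>) * fr.neg_norm q (w - w0) \<le> fr.neg_norm q (w0 - v0) + fr.pos_norm q (w0 - v0)"
  by (rule fr.neg_norm_cone_bound)
    (use assms in \<open>simp_all add: V_form qform_kappa_def Let_def \<pi>_prj\<close>)

section \<open>Decay\<close>

text \<open>The integral on the right-hand side of the positive squeezing estimate.\<close>
definition energy :: "'q \<Rightarrow> 'e \<Rightarrow> 'e \<Rightarrow> real \<Rightarrow> real" where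
  "energy q v w t = (LBINT s:{0..t}. exp (2 * \<beta> s q) * (norm (\<iota> (\<psi> s q v) - \<iota> (\<psi> s q w)))\<^sup>2)"

lemma rates_bounded: "bounded_rate \<alpha>0" "bounded_rate \<beta>0"
  using negative_squeezing positive_squeezing by (auto simp: negative_squeezing_def positive_squeezing_def)

lemma energy_increment:
  assumes "0 \<le> s" "s \<le> t"
    and "\<And>x. x \<in> {s<..t} \<Longrightarrow> m \<le> exp (2 * \<beta> x q) * (norm (\<iota> (\<psi> x q v) - \<iota> (\<psi> x q w)))\<^sup>2"
  shows "m * (t - s) \<le> energy q v w t - energy q v w s"
  unfolding energy_def
proof (rule set_integral_increment[OF _ assms])
  interpret \<iota>: bounded_linear \<iota> by (rule embedding)
  have "continuous_on {0..} (\<lambda>x. exp (2 * \<beta> x q) * (norm (\<iota> (\<psi> x q v) - \<iota> (\<psi> x q w)))\<^sup>2)"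
    by (intro continuous_intros \<iota>.continuous_on continuous_time
        continuous_on_rate_integral semiflow rates_bounded)
  then show "set_integrable lborel {0..t} (\<lambda>x. exp (2 * \<beta> x q) * (norm (\<iota> (\<psi> x q v) - \<iota> (\<psi> x q w)))\<^sup>2)"
    by (intro borel_integrable_atLeastAtMost') (auto elim: continuous_on_subset)
qed

lemma energy_mono: "mono_on {0..} (energy q v w)"
  using energy_increment[of _ _ 0 q v w] by (intro mono_onI) auto

lemma energy_0: "energy q v w 0 = 0"
  unfolding energy_def by (rule set_integral_point)

lemma energy_nonneg: "t \<ge> 0 \<Longrightarrow> energy q v w t \<ge> 0"
  using mono_onD[OF energy_mono, of 0 t q v w] by (simp add: energy_0)

text \<open>
  In the positive squeezing estimate at a time \<open>r \<ge> \<tau>\<close> the first term is nonnegative and can be dropped.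
  For earlier times the bound follows since the energy increases.
\<close>

lemma energy_bound:
  assumes w: "w \<in> positive_class \<theta> \<psi> Q q v" and "t \<ge> 0"
  shows "energy q w v t \<le> V q (w - v) / \<delta>"
proof -
  define r where "r = max t \<tau>"
  have r: "r \<ge> \<tau>" "r \<ge> t" by (auto simp: r_def)
  have pos: "V (\<theta> r q) (\<psi> r q w - \<psi> r q v) \<ge> 0"
    using w r \<open>t \<ge> 0\<close> by (simp add: positive_class_def)
  then have "squeezing_estimate \<theta> \<psi> Q \<iota> \<beta>0 \<delta> r q w v"
    using positive_squeezing r by (simp add: positive_squeezing_def)
  then have "exp (2 * \<beta> r q) * V (\<theta> r q) (\<psi> r q w - \<psi> r q v) - V q (w - v) \<le> - \<delta> * energy q w v r"
    by (simp add: squeezing_estimate_def energy_def)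
  moreover have "exp (2 * \<beta> r q) * V (\<theta> r q) (\<psi> r q w - \<psi> r q v) \<ge> 0" using pos by simp
  ultimately have "\<delta> * energy q w v r \<le> V q (w - v)" by linarith
  moreover have "energy q w v t \<le> energy q w v r" using r \<open>t \<ge> 0\<close> by (intro mono_onD[OF energy_mono]) auto
  ultimately show ?thesis using \<delta>_pos by (simp add: field_simps) (smt (verit) mult_left_mono)
qed

text \<open>
  The cocycle property gives a bound of the norm at time \<open>t\<close> by the Hilbert norm at each earlier time
  \<open>s \<in> {t - \<sigma> - 1..t - \<sigma>}\<close>, with one constant, and the weight \<open>exp \<beta>\<close> changes only by a bounded factor over
  this time. Hence the integrand of the energy is bounded below there, and its integral over that interval of length one
  dominates the square of the weighted norm at time \<open>t\<close>. Times up to \<open>\<sigma> + 1\<close> are covered by the plain Lipschitz bound.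
\<close>

lemma smoothing:
  obtains \<sigma> C where "\<sigma> \<ge> 0" "C > 0"
    "\<And>q v w t. t \<ge> \<sigma> + 1 \<Longrightarrow>
      (exp (\<beta> t q) * norm (\<psi> t q v - \<psi> t q w))\<^sup>2 \<le> C * (energy q v w (t - \<sigma>) - energy q v w (t - \<sigma> - 1))"
    "\<And>q v w t. 0 \<le> t \<Longrightarrow> t \<le> \<sigma> + 1 \<Longrightarrow>
      exp (\<beta> t q) * norm (\<psi> t q v - \<psi> t q w) \<le> C * norm (v - w)"
proof -
  obtain \<sigma> where \<sigma>: "\<sigma> \<ge> 0" "\<forall>T>0. \<exists>L>0. \<forall>q v1 v2.
        (\<forall>t\<in>{\<sigma>..\<sigma> + T}. norm (\<psi> t q v1 - \<psi> t q v2) \<le> L * norm (\<iota> v1 - \<iota> v2)) \<and>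
        (\<forall>t\<in>{0..T}. norm (\<psi> t q v1 - \<psi> t q v2) \<le> L * norm (v1 - v2))"
    using uniformly_Lipschitz unfolding uniformly_Lipschitz_def by blast
  \<comment> \<open>One constant serves smoothing over delays in \<open>{\<sigma>..\<sigma> + 1}\<close> and plain Lipschitz continuity up to time \<open>\<sigma> + 1\<close>.\<close>
  have "\<sigma> + 1 > 0" using \<sigma>(1) by simp
  from \<sigma>(2)[rule_format, OF this] obtain L where L: "L > 0"
    "\<And>q v1 v2 t. \<sigma> \<le> t \<Longrightarrow> t \<le> \<sigma> + (\<sigma> + 1) \<Longrightarrow> norm (\<psi> t q v1 - \<psi> t q v2) \<le> L * norm (\<iota> v1 - \<iota> v2)"
    "\<And>q v1 v2 t. 0 \<le> t \<Longrightarrow> t \<le> \<sigma> + 1 \<Longrightarrow> norm (\<psi> t q v1 - \<psi> t q v2) \<le> L * norm (v1 - v2)"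
    by (metis atLeastAtMost_iff)
  obtain c where c: "c \<ge> 0"
    "\<And>q s t. 0 \<le> s \<Longrightarrow> s \<le> t \<Longrightarrow> \<bar>\<beta> t q - \<beta> s q\<bar> \<le> c * (t - s)"
    using rate_integral_increment[OF semiflow rates_bounded(2)] by blast
  define D where "D = L * exp (c * (\<sigma> + 1))"
  have "D > 0" using L by (simp add: D_def)
  define C where "C = max (D\<^sup>2) D"
  show ?thesis
  proof (rule that)
    show "\<sigma> \<ge> 0" by fact
    show "C > 0" using \<open>D > 0\<close> by (simp add: C_def)
  next
    fix q v w t assume t: "t \<ge> \<sigma> + 1"
    define X where "X = exp (\<beta> t q) * norm (\<psi> t q v - \<psi> t q w)"
    have low: "X\<^sup>2 / D\<^sup>2 \<le> exp (2 * \<beta> s q) * (norm (\<iota> (\<psi> s q v) - \<iota> (\<psi> s q w)))\<^sup>2"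
      if s: "s \<in> {t - \<sigma> - 1<..t - \<sigma>}" for s
    proof -
      have s': "s \<ge> 0" "t - s \<ge> \<sigma>" "t - s \<le> \<sigma> + 1" using s t by auto
      have "\<psi> t q u = \<psi> (t - s) (\<theta> s q) (\<psi> s q u)" for u
        using cocycle_add[of "t - s" s q u] s' \<sigma>(1) by simp
      then have "norm (\<psi> t q v - \<psi> t q w) \<le> L * norm (\<iota> (\<psi> s q v) - \<iota> (\<psi> s q w))"
        using L(2)[of "t - s" "\<theta> s q" "\<psi> s q v" "\<psi> s q w"] s' \<sigma>(1) by simp
      moreover have "exp (\<beta> t q) \<le> exp (c * (\<sigma> + 1)) * exp (\<beta> s q)"
      proof -
        have "\<beta> t q - \<beta> s q \<le> c * (t - s)" using c(2)[of s t q] s' \<sigma>(1) by simp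
        also have "\<dots> \<le> c * (\<sigma> + 1)" using s' c(1) by (intro mult_left_mono) auto
        finally show ?thesis by (simp flip: exp_add)
      qed
      ultimately have "X \<le> exp (c * (\<sigma> + 1)) * exp (\<beta> s q) * (L * norm (\<iota> (\<psi> s q v) - \<iota> (\<psi> s q w)))"
        unfolding X_def by (intro mult_mono) auto
      then have "X \<le> D * (exp (\<beta> s q) * norm (\<iota> (\<psi> s q v) - \<iota> (\<psi> s q w)))"
        by (simp add: D_def mult_ac)
      then have "X / D \<le> exp (\<beta> s q) * norm (\<iota> (\<psi> s q v) - \<iota> (\<psi> s q w))"
        using \<open>D > 0\<close> by (simp add: divide_le_eq mult.commute)
      then have "(X / D)\<^sup>2 \<le> (exp (\<beta> s q) * norm (\<iota> (\<psi> s q v) - \<iota> (\<psi> s q w)))\<^sup>2"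
        using \<open>D > 0\<close> by (intro power_mono) (auto simp: X_def)
      then show ?thesis by (simp add: power_divide power_mult_distrib exp_double mult.commute)
    qed
    have "X\<^sup>2 / D\<^sup>2 * ((t - \<sigma>) - (t - \<sigma> - 1)) \<le> energy q v w (t - \<sigma>) - energy q v w (t - \<sigma> - 1)"
      by (rule energy_increment) (use low t in auto)
    then have "X\<^sup>2 \<le> D\<^sup>2 * (energy q v w (t - \<sigma>) - energy q v w (t - \<sigma> - 1))"
      using \<open>D > 0\<close> by (simp add: divide_le_eq mult.commute)
    also have "\<dots> \<le> C * (energy q v w (t - \<sigma>) - energy q v w (t - \<sigma> - 1))"
      using mono_onD[OF energy_mono, of "t - \<sigma> - 1" "t - \<sigma>" q v w] t
      by (intro mult_right_mono) (auto simp: C_def)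
    finally show "X\<^sup>2 \<le> C * (energy q v w (t - \<sigma>) - energy q v w (t - \<sigma> - 1))" unfolding X_def .
  next
    fix q v w t assume t: "0 \<le> t" "t \<le> \<sigma> + 1"
    have "\<beta> t q \<le> c * t" using c(2)[of 0 t q] t by (simp add: rate_integral_0)
    also have "\<dots> \<le> c * (\<sigma> + 1)" using t c(1) by (intro mult_left_mono) auto
    finally have "exp (\<beta> t q) * norm (\<psi> t q v - \<psi> t q w) \<le> exp (c * (\<sigma> + 1)) * (L * norm (v - w))"
      using L(3)[of t q v w] t by (intro mult_mono) auto
    also have "\<dots> = D * norm (v - w)" by (simp add: D_def)
    also have "\<dots> \<le> C * norm (v - w)" by (intro mult_right_mono) (auto simp: C_def)
    finally show "exp (\<beta> t q) * norm (\<psi> t q v - \<psi> t q w) \<le> C * norm (v - w)" .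
  qed
qed

lemma class_decay:
  obtains D where "D > 0"
    "\<And>q v w t. w \<in> positive_class \<theta> \<psi> Q q v \<Longrightarrow> t \<ge> 0 \<Longrightarrow>
      norm (\<psi> t q w - \<psi> t q v) \<le> D * norm (w - v) * exp (- \<beta> t q)"
proof -
  obtain \<sigma> C where \<sigma>: "\<sigma> \<ge> 0" "C > 0" and
    late: "\<And>q v w t. t \<ge> \<sigma> + 1 \<Longrightarrow>
      (exp (\<beta> t q) * norm (\<psi> t q v - \<psi> t q w))\<^sup>2 \<le> C * (energy q v w (t - \<sigma>) - energy q v w (t - \<sigma> - 1))" and
    early: "\<And>q v w t. 0 \<le> t \<Longrightarrow> t \<le> \<sigma> + 1 \<Longrightarrow>
      exp (\<beta> t q) * norm (\<psi> t q v - \<psi> t q w) \<le> C * norm (v - w)"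
    using smoothing by metis
  define D where "D = max C (sqrt (C * K / \<delta>))"
  have weighted: "exp (\<beta> t q) * norm (\<psi> t q w - \<psi> t q v) \<le> D * norm (w - v)"
    if w: "w \<in> positive_class \<theta> \<psi> Q q v" and "t \<ge> 0" for q v w t
  proof (cases "t \<le> \<sigma> + 1")
    case True
    then have "exp (\<beta> t q) * norm (\<psi> t q w - \<psi> t q v) \<le> C * norm (w - v)"
      using early \<open>t \<ge> 0\<close> by blast
    also have "\<dots> \<le> D * norm (w - v)" by (intro mult_right_mono) (auto simp: D_def)
    finally show ?thesis .
  next
    case False
    have "energy q w v (t - \<sigma>) - energy q w v (t - \<sigma> - 1) \<le> V q (w - v) / \<delta>"
      using energy_bound[OF w, of "t - \<sigma>"] energy_nonneg[of "t - \<sigma> - 1" q w v] False by simp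
    also have "\<dots> \<le> K * (norm (w - v))\<^sup>2 / \<delta>"
      using V_abs_le[of q "w - v"] \<delta>_pos by (intro divide_right_mono) auto
    finally have "C * (energy q w v (t - \<sigma>) - energy q w v (t - \<sigma> - 1)) \<le> C * (K * (norm (w - v))\<^sup>2 / \<delta>)"
      using \<sigma> by (intro mult_left_mono) auto
    with late[of t q w v] False
    have "(exp (\<beta> t q) * norm (\<psi> t q w - \<psi> t q v))\<^sup>2 \<le> C * K / \<delta> * (norm (w - v))\<^sup>2" by simp
    then have "exp (\<beta> t q) * norm (\<psi> t q w - \<psi> t q v) \<le> sqrt (C * K / \<delta> * (norm (w - v))\<^sup>2)"
      by (rule real_le_rsqrt)
    also have "\<dots> = sqrt (C * K / \<delta>) * norm (w - v)"
      by (simp only: real_sqrt_mult real_sqrt_abs abs_norm_cancel)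
    also have "\<dots> \<le> D * norm (w - v)" by (intro mult_right_mono) (auto simp: D_def)
    finally show ?thesis .
  qed
  have est: "norm (\<psi> t q w - \<psi> t q v) \<le> D * norm (w - v) * exp (- \<beta> t q)"
    if "w \<in> positive_class \<theta> \<psi> Q q v" "t \<ge> 0" for q v w t
    using weighted[OF that] unfolding exp_minus by (simp add: field_simps)
  have "D > 0" using \<sigma> by (simp add: D_def)
  then show ?thesis by (rule that[OF _ est])
qed

lemma class_form_nonneg:
  assumes "v \<in> positive_class \<theta> \<psi> Q q v0"
  shows "V q (v - v0) \<ge> 0"
proof -
  have "\<forall>t\<ge>0. V (\<theta> t q) (\<psi> t q v - \<psi> t q v0) \<ge> 0"
    using assms by (simp only: positive_class_def mem_Collect_eq)
  from this[rule_format, of 0] show ?thesis by (simp add: flow_0 cocycle_0)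
qed

text \<open>
  For any competitor \<open>w0\<close> in \<open>M\<close> the cone bound controls the negative part of \<open>w - w0\<close> by \<open>w0 - v0\<close>. The
  constant \<open>C_inv\<close> turns this into a bound on the norm of the projection of \<open>w - w0\<close>, and the Lipschitz
  inverse of the projection on \<open>M\<close> into one on the norm of \<open>w - w0\<close>.
\<close>

lemma class_distance_le_infdist:
  assumes adm: "Lipschitz_admissible L \<kappa> (Q q) (Em q) M" and \<kappa>: "0 < \<kappa>" "\<kappa> < 1"
    and w: "w \<in> M" "w \<in> positive_class \<theta> \<psi> Q q v0"
  shows "norm (w - v0) \<le> (1 + sqrt K * (1 + 2 * p) * C_inv (Q q) (Em q) * (1 / (1 - \<kappa>)) * L) * infdist v0 M"
proof -
  let ?B = "1 + sqrt K * (1 + 2 * p) * C_inv (Q q) (Em q) * (1 / (1 - \<kappa>)) * L"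
  have V0: "V q (w - v0) \<ge> 0" using w(2) by (rule class_form_nonneg)
  have L0: "L \<ge> 0" using adm by (auto simp: Lipschitz_admissible_def lipschitz_on_def)
  have inj: "inj_on (\<pi> q) M" and im: "\<pi> q ` M = Em q"
    using adm by (auto simp: Lipschitz_admissible_def admissible_def homeomorphism_def intro: inj_on_inverseI)
  have bound: "norm (w - v0) \<le> ?B * dist v0 w0" if w0: "w0 \<in> M" for w0
  proof -
    define a where "a = fr.neg_norm q (w - w0)"
    have "qform_kappa \<kappa> (Q q) (Em q) (w - w0) \<le> 0"
      using adm w(1) w0 by (simp add: Lipschitz_admissible_def admissible_def)
    from neg_norm_cone_bound[OF \<kappa> this V0]
    have "(1 - \<kappa>) * a \<le> sqrt K * (1 + 2 * p) * norm (w0 - v0)"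
      using neg_norm_le[of q "w0 - v0"] pos_norm_le[of q "w0 - v0"] by (simp add: a_def algebra_simps)
    then have a: "a \<le> (1 / (1 - \<kappa>)) * (sqrt K * (1 + 2 * p) * norm (w0 - v0))"
      using \<kappa> by (simp add: field_simps)
    have "dist w w0 \<le> L * dist (\<pi> q w) (\<pi> q w0)"
    proof -
      have "L-lipschitz_on (Em q) (inv_into M (\<pi> q))" using adm by (simp add: Lipschitz_admissible_def)
      from lipschitz_onD[OF this, of "\<pi> q w" "\<pi> q w0"] show ?thesis
        using inj w(1) w0 \<pi>_in by simp
    qed
    also have "\<dots> = L * norm (\<pi> q (w - w0))" by (simp add: dist_norm blinfun.diff_right)
    also have "\<dots> \<le> L * (C_inv (Q q) (Em q) * a)"
      unfolding a_def using L0 by (intro mult_left_mono norm_\<pi>_le)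
    also have "\<dots> \<le> L * (C_inv (Q q) (Em q) * ((1 / (1 - \<kappa>)) * (sqrt K * (1 + 2 * p) * norm (w0 - v0))))"
      using L0 C_inv_Em_nonneg a by (intro mult_left_mono)
    finally have "norm (w - w0) \<le> (?B - 1) * norm (w0 - v0)"
      by (simp add: dist_norm mult_ac)
    moreover have "norm (w - v0) \<le> norm (w - w0) + norm (w0 - v0)"
      using norm_triangle_ineq[of "w - w0" "w0 - v0"] by simp
    ultimately show ?thesis by (simp add: algebra_simps dist_norm norm_minus_commute)
  qed
  have Bpos: "?B > 0"
    using K_pos p_nonneg C_inv_Em_nonneg[of q] \<kappa> L0 by (intro add_pos_nonneg mult_nonneg_nonneg) auto
  have M0: "M \<noteq> {}" using w(1) by auto
  have "norm (w - v0) / ?B \<le> infdist v0 M"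
    unfolding infdist_notempty[OF M0]
  proof (rule cINF_greatest[OF M0])
    fix w0 assume "w0 \<in> M"
    from bound[OF this] show "norm (w - v0) / ?B \<le> dist v0 w0"
      unfolding pos_divide_le_eq[OF Bpos] by (simp only: mult.commute)
  qed
  then show ?thesis unfolding pos_divide_le_eq[OF Bpos] by (simp only: mult.commute)
qed

section \<open>Existence\<close>

lemma admissible_V:
  assumes "admissible \<kappa> (Q q) (Em q) M" "w \<in> M" "w' \<in> M"
  shows "V q (w - w') \<le> - ((1 - \<kappa>\<^sup>2) * (fr.neg_norm q (w - w'))\<^sup>2)"
proof -
  have "qform_kappa \<kappa> (Q q) (Em q) (w - w') \<le> 0"
    using assms by (simp add: admissible_def)
  then show ?thesis
    unfolding qform_kappa_eq V_form fr.form_norms by (simp add: algebra_simps)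
qed

lemma squeeze_V:
  assumes "V q (v - w) \<le> 0" "r \<ge> \<tau>"
  shows "exp (2 * \<alpha> r q) * V (\<theta> r q) (\<psi> r q v - \<psi> r q w) \<le> V q (v - w)"
proof -
  have "squeezing_estimate \<theta> \<psi> Q \<iota> \<alpha>0 \<delta> r q v w"
    using negative_squeezing assms by (simp add: negative_squeezing_def)
  moreover have "(LBINT s:{0..r}. exp (2 * \<alpha> s q) * (norm (\<iota> (\<psi> s q v) - \<iota> (\<psi> s q w)))\<^sup>2) \<ge> 0"
    unfolding set_lebesgue_integral_def by (intro Bochner_Integration.integral_nonneg) (simp add: indicator_def)
  ultimately show ?thesis
    using \<delta>_pos unfolding squeezing_estimate_def
    by (smt (verit) mult_nonneg_nonneg mult_minus_left)
qed

text \<open>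
  Negative squeezing from time \<open>t\<close> on would carry a negative value to a negative value at time \<open>T\<close>.
\<close>

lemma V_nonneg_backwards:
  assumes "V (\<theta> T q) (\<psi> T q v - \<psi> T q w) \<ge> 0" "0 \<le> t" "t + \<tau> \<le> T"
  shows "V (\<theta> t q) (\<psi> t q v - \<psi> t q w) \<ge> 0"
proof (rule ccontr)
  assume neg: "\<not> ?thesis"
  have T: "\<theta> T q = \<theta> (T - t) (\<theta> t q)" "\<psi> T q u = \<psi> (T - t) (\<theta> t q) (\<psi> t q u)" for u
    using flow_add[of "T - t" t q] cocycle_add[of "T - t" t q u] assms \<tau>_nonneg by auto
  have "exp (2 * \<alpha> (T - t) (\<theta> t q)) * V (\<theta> T q) (\<psi> T q v - \<psi> T q w)
      \<le> V (\<theta> t q) (\<psi> t q v - \<psi> t q w)"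
    unfolding T by (rule squeeze_V) (use neg assms in auto)
  moreover have "0 \<le> exp (2 * \<alpha> (T - t) (\<theta> t q)) * V (\<theta> T q) (\<psi> T q v - \<psi> T q w)"
    using assms(1) by simp
  ultimately show False using neg by linarith
qed

text \<open>
  Parametrize \<open>M\<close> by its projection to \<open>E\<^sup>-(q)\<close>, transport it to time \<open>T\<close> and project again. Differences
  within \<open>M\<close> have \<open>V\<close> below a negative multiple of their squared projection, and negative squeezing preserves
  this up to the factor \<open>exp (- 2 * \<alpha>)\<close>; thus the composite map expands distances, and it is onto.
\<close>

lemma admissible_reaches_projection:
  assumes adm: "admissible \<kappa> (Q q) (Em q) M" and \<kappa>: "0 < \<kappa>" "\<kappa> < 1" and "T \<ge> \<tau>"
  shows "\<exists>w\<in>M. \<pi> (\<theta> T q) (\<psi> T q w) = \<pi> (\<theta> T q) (\<psi> T q v0)"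
proof -
  obtain g where g: "homeomorphism M (Em q) (\<pi> q) g" using adm by (auto simp: admissible_def)
  have T0: "T \<ge> 0" using \<open>T \<ge> \<tau>\<close> \<tau>_nonneg by simp
  define q' where "q' = \<theta> T q"
  define G where "G y = \<pi> q' (\<psi> T q (g y))" for y
  define E where "E = (\<Sum>i<n. norm (e q i)) + 1"
  have E: "E > 0" unfolding E_def by (intro add_nonneg_pos sum_nonneg) auto
  \<comment> \<open>The factor \<open>E\<close> compares the norm with the form on \<open>E\<^sup>-(q)\<close>, and \<open>sqrt K\<close> the form with the norm at time \<open>T\<close>.\<close>
  define c where "c = exp (- \<alpha> T q) * sqrt (1 - \<kappa>\<^sup>2) / (E * sqrt K)"
  have \<kappa>1: "1 - \<kappa>\<^sup>2 > 0" using \<kappa> by (simp add: power_less_one_iff)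
  have "c > 0" unfolding c_def using \<kappa>1 E K_pos by simp
  have gM: "g y \<in> M" "\<pi> q (g y) = y" if "y \<in> Em q" for y
    using g that by (auto simp: homeomorphism_def)
  have cont: "continuous_on (Em q) G"
    unfolding G_def
    by (intro continuous_intros continuous_on_compose2[OF continuous_state[OF T0, of UNIV]])
      (use g in \<open>auto simp: homeomorphism_def\<close>)
  have expand: "c * dist x y \<le> dist (G x) (G y)" if "x \<in> Em q" "y \<in> Em q" for x y
  proof -
    define d where "d = \<psi> T q (g x) - \<psi> T q (g y)"
    have "x - y \<in> Em q" using that span_frame[of q] span_diff by metis
    then have "x - y \<in> fr.N q" by (simp add: span_frame)
    moreover have "\<pi> q (g x - g y) = x - y" using gM that by (simp add: blinfun.diff_right)
    ultimately have nn: "fr.neg_norm q (g x - g y) = sqrt (- rform (Q q) (x - y) (x - y))"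
      and le: "norm (x - y) \<le> (\<Sum>i<n. norm (e q i)) * sqrt (- rform (Q q) (x - y) (x - y))"
      using fr.norm_le_form[of "x - y" q] by (simp_all add: fr.neg_norm_def \<pi>_prj)
    have "norm (x - y) \<le> E * fr.neg_norm q (g x - g y)"
      using le fr.neg_norm_nonneg[of q "g x - g y"] unfolding nn[symmetric] E_def
      by (simp add: algebra_simps)
    then have 1: "norm (x - y) / E \<le> fr.neg_norm q (g x - g y)"
      using E by (simp add: divide_le_eq mult.commute)
    have adV: "V q (g x - g y) \<le> - ((1 - \<kappa>\<^sup>2) * (fr.neg_norm q (g x - g y))\<^sup>2)"
      using adm gM that by (intro admissible_V) auto
    then have "V q (g x - g y) \<le> 0" using \<kappa>1 by (smt (verit) mult_nonneg_nonneg zero_le_power2)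
    from squeeze_V[OF this \<open>T \<ge> \<tau>\<close>] adV
    have "exp (2 * \<alpha> T q) * V q' d \<le> - ((1 - \<kappa>\<^sup>2) * (fr.neg_norm q (g x - g y))\<^sup>2)"
      by (simp add: d_def q'_def)
    moreover have "- (fr.neg_norm q' d)\<^sup>2 \<le> V q' d" by (simp add: V_form fr.form_norms)
    then have "exp (2 * \<alpha> T q) * - (fr.neg_norm q' d)\<^sup>2 \<le> exp (2 * \<alpha> T q) * V q' d"
      by (intro mult_left_mono) auto
    ultimately have "(1 - \<kappa>\<^sup>2) * (fr.neg_norm q (g x - g y))\<^sup>2 \<le> exp (2 * \<alpha> T q) * (fr.neg_norm q' d)\<^sup>2"
      by simp
    then have "(sqrt (1 - \<kappa>\<^sup>2) * fr.neg_norm q (g x - g y))\<^sup>2 \<le> (exp (\<alpha> T q) * fr.neg_norm q' d)\<^sup>2"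
      using \<kappa>1 by (simp add: power_mult_distrib exp_double)
    then have 2: "sqrt (1 - \<kappa>\<^sup>2) * fr.neg_norm q (g x - g y) \<le> exp (\<alpha> T q) * fr.neg_norm q' d"
      by (rule power2_le_imp_le) (simp add: fr.neg_norm_nonneg)
    have "c * norm (x - y) = exp (- \<alpha> T q) / sqrt K * (sqrt (1 - \<kappa>\<^sup>2) * (norm (x - y) / E))"
      by (simp add: c_def mult_ac)
    also have "\<dots> \<le> exp (- \<alpha> T q) / sqrt K * (sqrt (1 - \<kappa>\<^sup>2) * fr.neg_norm q (g x - g y))"
      using 1 \<kappa>1 K_pos by (intro mult_left_mono) auto
    also have "\<dots> \<le> exp (- \<alpha> T q) / sqrt K * (exp (\<alpha> T q) * fr.neg_norm q' d)"
      using 2 K_pos by (intro mult_left_mono) auto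
    also have "\<dots> = fr.neg_norm q' d / sqrt K" by (simp add: exp_minus)
    also have "\<dots> \<le> norm (\<pi> q' d)"
      using neg_norm_\<pi>[of q' d] K_pos by (simp add: divide_le_eq mult.commute)
    also have "\<pi> q' d = G x - G y" by (simp add: G_def d_def blinfun.diff_right)
    finally show ?thesis by (simp add: dist_norm)
  qed
  have "G ` span (e q ` {..<n}) = span (e q' ` {..<n})"
    by (rule expanding_map_onto[OF fr.negative_frame_axioms fr.negative_frame_axioms _ _ \<open>c > 0\<close>])
      (use cont expand \<pi>_in in \<open>auto simp: span_frame G_def\<close>)
  then have "\<pi> q' (\<psi> T q v0) \<in> G ` Em q" using \<pi>_in by (simp add: span_frame)
  then show ?thesis using gM by (auto simp: G_def q'_def)
qed

text \<open>
  The points found for \<open>T = k + \<tau>\<close> satisfy \<open>V \<ge> 0\<close> on \<open>{0..k}\<close>. Their projections stay in a compact set by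
  the cone bound, so a subsequence converges, first after projection and then in \<open>M\<close>, because \<open>M\<close> is homeomorphic to
  the fibre. The inequalities at each fixed time are closed conditions.
\<close>

lemma admissible_meets_class:
  assumes adm: "admissible \<kappa> (Q q) (Em q) M" and \<kappa>: "0 < \<kappa>" "\<kappa> < 1"
  shows "\<exists>w. w \<in> M \<and> w \<in> positive_class \<theta> \<psi> Q q v0"
proof -
  obtain g where g: "homeomorphism M (Em q) (\<pi> q) g" using adm by (auto simp: admissible_def)
  have "\<exists>w. w \<in> M \<and> (\<forall>t. 0 \<le> t \<and> t \<le> real k \<longrightarrow> V (\<theta> t q) (\<psi> t q w - \<psi> t q v0) \<ge> 0)" for k :: nat
  proof -
    let ?T = "real k + \<tau>"
    obtain w where w: "w \<in> M" "\<pi> (\<theta> ?T q) (\<psi> ?T q w) = \<pi> (\<theta> ?T q) (\<psi> ?T q v0)"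
      using admissible_reaches_projection[OF adm \<kappa>, of ?T v0] by auto
    let ?d = "\<psi> ?T q w - \<psi> ?T q v0"
    have "fr.neg_norm (\<theta> ?T q) ?d \<le> 0"
      using neg_norm_\<pi>[of "\<theta> ?T q" ?d] w(2) by (simp add: blinfun.diff_right)
    then have "fr.neg_norm (\<theta> ?T q) ?d = 0" using fr.neg_norm_nonneg[of "\<theta> ?T q" ?d] by simp
    then have "V (\<theta> ?T q) ?d \<ge> 0" by (simp add: V_form fr.form_norms)
    then have "V (\<theta> t q) (\<psi> t q w - \<psi> t q v0) \<ge> 0" if "0 \<le> t" "t \<le> real k" for t
      by (rule V_nonneg_backwards) (use that in auto)
    then show ?thesis using w(1) by blast
  qed
  from choice[OF allI, OF this] obtain w where "\<forall>k. w k \<in> M \<and>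
      (\<forall>t. 0 \<le> t \<and> t \<le> real k \<longrightarrow> V (\<theta> t q) (\<psi> t q (w k) - \<psi> t q v0) \<ge> 0)" ..
  then have w: "w k \<in> M" "0 \<le> t \<Longrightarrow> t \<le> real k \<Longrightarrow> V (\<theta> t q) (\<psi> t q (w k) - \<psi> t q v0) \<ge> 0" for k t
    by auto
  define r where "r = (fr.neg_norm q (w 0 - v0) + fr.pos_norm q (w 0 - v0)) / (1 - \<kappa>)"
  have bound: "fr.neg_norm q (w k - w 0) \<le> r" for k
  proof -
    have "(1 - \<kappa>) * fr.neg_norm q (w k - w 0) \<le> fr.neg_norm q (w 0 - v0) + fr.pos_norm q (w 0 - v0)"
      by (rule neg_norm_cone_bound[OF \<kappa>])
        (use adm w(1) w(2)[of 0 k] in \<open>auto simp: admissible_def flow_0 cocycle_0\<close>)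
    then show ?thesis using \<kappa> by (simp add: r_def field_simps)
  qed
  obtain S where S: "compact S" "{v \<in> fr.N q. sqrt (- rform (Q q) v v) \<le> r} \<subseteq> S"
    using fr.bounded_in_compact by blast
  have "\<pi> q (w k - w 0) \<in> S" for k
    using bound[of k] fr.prj_in[of q "w k - w 0"] S(2) by (auto simp: fr.neg_norm_def \<pi>_prj)
  then obtain l \<phi> where l: "strict_mono (\<phi> :: nat \<Rightarrow> nat)" "((\<lambda>k. \<pi> q (w k - w 0)) \<circ> \<phi>) \<longlonglongrightarrow> l"
    using S(1) unfolding compact_def by metis
  define y where "y = l + \<pi> q (w 0)"
  have "(\<lambda>k. \<pi> q (w (\<phi> k) - w 0) + \<pi> q (w 0)) \<longlonglongrightarrow> y"
    unfolding y_def using l(2) by (intro tendsto_intros) (simp add: o_def)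
  then have y: "(\<lambda>k. \<pi> q (w (\<phi> k))) \<longlonglongrightarrow> y" by (simp add: blinfun.diff_right)
  have "closed (Em q)" using fr.closed_frame[of q] by (simp add: span_frame)
  then have yE: "y \<in> Em q" by (rule closed_sequentially[OF _ \<pi>_in y])
  have "(\<lambda>k. g (\<pi> q (w (\<phi> k)))) \<longlonglongrightarrow> g y"
    by (rule continuous_on_tendsto_compose[OF _ y yE]) (use g \<pi>_in in \<open>auto simp: homeomorphism_def\<close>)
  moreover have "g (\<pi> q (w k)) = w k" for k using g w(1) by (auto simp: homeomorphism_def)
  ultimately have lim: "(\<lambda>k. w (\<phi> k)) \<longlonglongrightarrow> g y" by simp
  have "V (\<theta> t q) (\<psi> t q (g y) - \<psi> t q v0) \<ge> 0" if "t \<ge> 0" for t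
  proof (rule tendsto_lowerbound)
    have "(\<lambda>k. \<psi> t q (w (\<phi> k))) \<longlonglongrightarrow> \<psi> t q (g y)"
      by (rule continuous_on_tendsto_compose[OF continuous_state[OF that, of UNIV] lim]) auto
    then show "(\<lambda>k. V (\<theta> t q) (\<psi> t q (w (\<phi> k)) - \<psi> t q v0)) \<longlonglongrightarrow> V (\<theta> t q) (\<psi> t q (g y) - \<psi> t q v0)"
      by (intro V_tendsto tendsto_intros)
    obtain m :: nat where m: "t \<le> real m" using real_arch_simple by blast
    have "0 \<le> V (\<theta> t q) (\<psi> t q (w (\<phi> k)) - \<psi> t q v0)" if "k \<ge> m" for k
      using w(2)[of t "\<phi> k"] \<open>t \<ge> 0\<close> m that seq_suble[OF l(1), of k] by simp
    then show "\<forall>\<^sub>F k in sequentially. 0 \<le> V (\<theta> t q) (\<psi> t q (w (\<phi> k)) - \<psi> t q v0)"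
      unfolding eventually_sequentially by blast
  qed simp
  moreover have "g y \<in> M" using g yE by (auto simp: homeomorphism_def)
  ultimately show ?thesis by (auto simp: positive_class_def)
qed

section \<open>Uniqueness\<close>

text \<open>
  The bounded increasing energy has vanishing increments, and these dominate the weighted distance.
\<close>

lemma weighted_distance_tendsto_0:
  assumes "w \<in> positive_class \<theta> \<psi> Q q v"
  shows "((\<lambda>t. exp (\<beta> t q) * norm (\<psi> t q w - \<psi> t q v)) \<longlongrightarrow> 0) at_top"
proof -
  obtain \<sigma> C where \<sigma>: "\<sigma> \<ge> 0" "C > 0" and
    late: "\<And>q v w t. t \<ge> \<sigma> + 1 \<Longrightarrow>
      (exp (\<beta> t q) * norm (\<psi> t q v - \<psi> t q w))\<^sup>2 \<le> C * (energy q v w (t - \<sigma>) - energy q v w (t - \<sigma> - 1))"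
    using smoothing by metis
  have "((\<lambda>t. energy q w v (t - \<sigma>) - energy q w v (t - \<sigma> - 1)) \<longlongrightarrow> 0) at_top"
    by (rule bounded_mono_increment_tendsto_0[OF energy_mono energy_bound[OF assms]])
  then have "((\<lambda>t. C * (energy q w v (t - \<sigma>) - energy q w v (t - \<sigma> - 1))) \<longlongrightarrow> C * 0) at_top"
    by (intro tendsto_intros)
  then have lim: "((\<lambda>t. C * (energy q w v (t - \<sigma>) - energy q w v (t - \<sigma> - 1))) \<longlongrightarrow> 0) at_top" by simp
  have "((\<lambda>t. (exp (\<beta> t q) * norm (\<psi> t q w - \<psi> t q v))\<^sup>2) \<longlongrightarrow> 0) at_top"
  proof (rule tendsto_sandwich[OF _ _ tendsto_const lim])
    show "\<forall>\<^sub>F t in at_top. (exp (\<beta> t q) * norm (\<psi> t q w - \<psi> t q v))\<^sup>2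
        \<le> C * (energy q w v (t - \<sigma>) - energy q w v (t - \<sigma> - 1))"
      unfolding eventually_at_top_linorder using late by blast
  qed simp
  from tendsto_real_sqrt[OF this] show ?thesis by (simp add: real_sqrt_abs abs_mult)
qed

text \<open>
  For two distinct points the initial value \<open>- c\<close> of \<open>V\<close> is negative, and negative squeezing gives
  \<open>c \<le> - exp (2 * \<alpha>) * V \<le> K * exp (2 * (\<alpha> - \<beta>)) * X\<^sup>2\<close>, where the weighted distance \<open>X\<close> tends to zero.
  This is possible only if \<open>\<alpha> - \<beta>\<close> tends to infinity.
\<close>

lemma admissible_class_unique:
  assumes adm: "admissible \<kappa> (Q q) (Em q) M" and \<kappa>: "0 < \<kappa>" "\<kappa> < 1"
    and rates: "rates_compatible \<theta> \<alpha>0 \<beta>0 q"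
    and w: "w \<in> M" "w \<in> positive_class \<theta> \<psi> Q q v0"
    and w': "w' \<in> M" "w' \<in> positive_class \<theta> \<psi> Q q v0"
  shows "w = w'"
proof (rule ccontr)
  assume "w \<noteq> w'"
  obtain g where g: "homeomorphism M (Em q) (\<pi> q) g" using adm by (auto simp: admissible_def)
  have "\<pi> q w \<noteq> \<pi> q w'" using \<open>w \<noteq> w'\<close> g w(1) w'(1) unfolding homeomorphism_def by metis
  then have "\<pi> q (w - w') \<noteq> 0" by (simp add: blinfun.diff_right)
  then have "fr.neg_norm q (w - w') \<noteq> 0"
    using norm_\<pi>_le[of q "w - w'"] by auto
  moreover have "1 - \<kappa>\<^sup>2 > 0" using \<kappa> by (simp add: power_less_one_iff)
  ultimately have "(1 - \<kappa>\<^sup>2) * (fr.neg_norm q (w - w'))\<^sup>2 > 0" by simp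
  then have neg: "V q (w - w') < 0" using admissible_V[OF adm w(1) w'(1)] by simp
  define c where "c = - V q (w - w')"
  have "c > 0" using neg by (simp add: c_def)
  define X where "X t = exp (\<beta> t q) * norm (\<psi> t q w - \<psi> t q w')" for t
  have "((\<lambda>t. exp (\<beta> t q) * norm (\<psi> t q w - \<psi> t q v0) + exp (\<beta> t q) * norm (\<psi> t q w' - \<psi> t q v0)) \<longlongrightarrow> 0 + 0) at_top"
    by (intro tendsto_add weighted_distance_tendsto_0 w w')
  then have sum0: "((\<lambda>t. exp (\<beta> t q) * norm (\<psi> t q w - \<psi> t q v0) + exp (\<beta> t q) * norm (\<psi> t q w' - \<psi> t q v0)) \<longlongrightarrow> 0) at_top"
    by simp
  have X0: "(X \<longlongrightarrow> 0) at_top"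
  proof (rule tendsto_sandwich[OF _ _ tendsto_const sum0])
    show "\<forall>\<^sub>F t in at_top. 0 \<le> X t" by (simp add: X_def)
    show "\<forall>\<^sub>F t in at_top. X t \<le> exp (\<beta> t q) * norm (\<psi> t q w - \<psi> t q v0) + exp (\<beta> t q) * norm (\<psi> t q w' - \<psi> t q v0)"
    proof (intro always_eventually allI)
      fix t
      have "norm (\<psi> t q w - \<psi> t q w') \<le> norm (\<psi> t q w - \<psi> t q v0) + norm (\<psi> t q w' - \<psi> t q v0)"
        using norm_triangle_ineq4[of "\<psi> t q w - \<psi> t q v0" "\<psi> t q w' - \<psi> t q v0"] by simp
      then show "X t \<le> exp (\<beta> t q) * norm (\<psi> t q w - \<psi> t q v0) + exp (\<beta> t q) * norm (\<psi> t q w' - \<psi> t q v0)"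
        unfolding X_def distrib_left[symmetric] by (intro mult_left_mono) auto
    qed
  qed
  have main: "c \<le> K * exp (2 * (\<alpha> t q - \<beta> t q)) * (X t)\<^sup>2" if "t \<ge> \<tau>" for t
  proof -
    let ?d = "\<psi> t q w - \<psi> t q w'"
    have "exp (2 * \<alpha> t q) * V (\<theta> t q) ?d \<le> - c"
      using squeeze_V[OF less_imp_le[OF neg] that] by (simp add: c_def)
    moreover have "exp (2 * \<alpha> t q) * - (K * (norm ?d)\<^sup>2) \<le> exp (2 * \<alpha> t q) * V (\<theta> t q) ?d"
      using V_abs_le[of "\<theta> t q" ?d] by (intro mult_left_mono) auto
    ultimately have "c \<le> exp (2 * \<alpha> t q) * (K * (norm ?d)\<^sup>2)" by simp
    also have "\<dots> = K * exp (2 * (\<alpha> t q - \<beta> t q)) * (X t)\<^sup>2"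
      by (simp add: X_def power_mult_distrib right_diff_distrib exp_diff exp_double)
    finally show ?thesis .
  qed
  have "filterlim (\<lambda>t. \<alpha> t q - \<beta> t q) at_top at_top"
    unfolding filterlim_at_top
  proof
    fix Z :: real
    \<comment> \<open>This value makes the inequality \<open>main\<close> at \<open>X = \<epsilon>\<close> say exactly \<open>Z \<le> \<alpha> - \<beta>\<close>.\<close>
    define \<epsilon> where "\<epsilon> = sqrt (c / K) * exp (- Z)"
    have "\<epsilon> > 0" using \<open>c > 0\<close> K_pos by (simp add: \<epsilon>_def)
    have "\<forall>\<^sub>F t in at_top. X t < \<epsilon>"
      using order_tendstoD(2)[OF X0 \<open>\<epsilon> > 0\<close>] .
    then show "\<forall>\<^sub>F t in at_top. Z \<le> \<alpha> t q - \<beta> t q"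
      using eventually_ge_at_top[of \<tau>]
    proof eventually_elim
      case (elim t)
      have "(X t)\<^sup>2 \<le> \<epsilon>\<^sup>2" using elim(1) by (intro power_mono) (auto simp: X_def)
      then have "c \<le> K * exp (2 * (\<alpha> t q - \<beta> t q)) * \<epsilon>\<^sup>2"
        using main[OF elim(2)] K_pos by (smt (verit) mult_left_mono mult_pos_pos exp_gt_zero)
      also have "\<epsilon>\<^sup>2 = c / K * exp (- 2 * Z)"
        using \<open>c > 0\<close> K_pos by (simp add: \<epsilon>_def power_mult_distrib flip: exp_double)
      finally have "c \<le> c * (exp (2 * (\<alpha> t q - \<beta> t q)) * exp (- 2 * Z))"
        using K_pos by (simp add: mult_ac)
      then have "1 \<le> exp (2 * (\<alpha> t q - \<beta> t q)) * exp (- 2 * Z)"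
        using \<open>c > 0\<close> by simp
      then have "1 \<le> exp (2 * (\<alpha> t q - \<beta> t q) + (- 2 * Z))" by (simp only: exp_add)
      then have "0 \<le> 2 * (\<alpha> t q - \<beta> t q) + (- 2 * Z)" by (simp only: one_le_exp_iff)
      then show ?case by simp
    qed
  qed
  then show False using rates by (simp add: rates_compatible_def)
qed

lemma decay_estimate:
  shows "\<exists>R. nondecreasing3 R \<and>
    (\<forall>q M \<kappa> L v0 w. 0 < \<kappa> \<and> \<kappa> < 1 \<and> Lipschitz_admissible L \<kappa> (Q q) (Em q) M \<and>
       w \<in> M \<and> w \<in> positive_class \<theta> \<psi> Q q v0 \<longrightarrow>
       (\<forall>t\<ge>0. norm (\<psi> t q v0 - \<psi> t q w)
          \<le> R (C_inv (Q q) (Em q)) (1 / (1 - \<kappa>)) L * infdist v0 M * exp (- \<beta> t q)))"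
proof -
  obtain D where D: "D > 0"
    "\<And>q v w t. w \<in> positive_class \<theta> \<psi> Q q v \<Longrightarrow> t \<ge> 0 \<Longrightarrow>
      norm (\<psi> t q w - \<psi> t q v) \<le> D * norm (w - v) * exp (- \<beta> t q)"
    using class_decay by blast
  define S where "S = sqrt K * (1 + 2 * p)"
  have S: "S \<ge> 0" using K_pos p_nonneg by (simp add: S_def)
  define R where "R a b c = D * (1 + S * a * b * c)" for a b c :: real
  have "nondecreasing3 R"
    unfolding nondecreasing3_def R_def using D(1) S
    by (auto intro!: mono_onI mult_nonneg_nonneg add_nonneg_nonneg mult_left_mono mult_right_mono)
  moreover have "norm (\<psi> t q v0 - \<psi> t q w)
      \<le> R (C_inv (Q q) (Em q)) (1 / (1 - \<kappa>)) L * infdist v0 M * exp (- \<beta> t q)"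
    if "0 < \<kappa>" "\<kappa> < 1" "Lipschitz_admissible L \<kappa> (Q q) (Em q) M"
      "w \<in> M" "w \<in> positive_class \<theta> \<psi> Q q v0" "t \<ge> 0" for q M \<kappa> L v0 w t
  proof -
    have "norm (\<psi> t q v0 - \<psi> t q w) \<le> D * norm (w - v0) * exp (- \<beta> t q)"
      using D(2)[OF that(5,6)] by (simp add: norm_minus_commute)
    also have "\<dots> \<le> D * ((1 + S * C_inv (Q q) (Em q) * (1 / (1 - \<kappa>)) * L) * infdist v0 M) * exp (- \<beta> t q)"
      using D(1) class_distance_le_infdist[OF that(3,1,2,4,5)] unfolding S_def
      by (intro mult_right_mono mult_left_mono) auto
    finally show ?thesis by (simp add: R_def mult.assoc)
  qed
  ultimately show ?thesis by blast
qed

end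

theorem theorem3p2p1:
  fixes scE :: "'k::real_or_complex \<Rightarrow> 'e::banach \<Rightarrow> 'e"
    and scH :: "'k \<Rightarrow> 'h::banach \<Rightarrow> 'h"
    and ip :: "'h \<Rightarrow> 'h \<Rightarrow> 'k"
    and \<iota> :: "'e \<Rightarrow> 'h"
    and \<theta> :: "real \<Rightarrow> 'q::complete_space \<Rightarrow> 'q"
    and \<psi> :: "real \<Rightarrow> 'q \<Rightarrow> 'e \<Rightarrow> 'e"
    and j :: nat
    and Q :: "'q \<Rightarrow> ('e, 'k) form_operator"
    and Em :: "'q \<Rightarrow> 'e set"
    and \<alpha>0 \<beta>0 :: "'q \<Rightarrow> real"
    and \<delta> \<tau> :: real
  assumes "normed_space_over scE"
    and "hilbert_space_over scH ip"
    and "continuous_embedding scE scH \<iota>"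
    and "semiflow \<theta>"
    and "semicocycle \<theta> \<psi>"
    and "quadratic_family scE j Q Em"
    and "\<delta> > 0" and "\<tau> \<ge> 0"
    and "negative_squeezing \<theta> \<psi> Q \<iota> \<alpha>0 \<delta> \<tau>"
    and "positive_squeezing \<theta> \<psi> Q \<iota> \<beta>0 \<delta> \<tau>"
    and "uniformly_Lipschitz \<psi> \<iota>"
    and "bounded_projectors Q Em"
  shows "(\<forall>q M \<kappa> v0. 0 < \<kappa> \<and> \<kappa> < 1 \<and> admissible \<kappa> (Q q) (Em q) M \<longrightarrow>
            (\<exists>w. w \<in> M \<and> w \<in> positive_class \<theta> \<psi> Q q v0) \<and>
            (rates_compatible \<theta> \<alpha>0 \<beta>0 q \<longrightarrow>
               (\<exists>!w. w \<in> M \<and> w \<in> positive_class \<theta> \<psi> Q q v0))) \<and>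
         (\<exists>R. nondecreasing3 R \<and>
            (\<forall>q M \<kappa> L v0 w. 0 < \<kappa> \<and> \<kappa> < 1 \<and> Lipschitz_admissible L \<kappa> (Q q) (Em q) M \<and>
               w \<in> M \<and> w \<in> positive_class \<theta> \<psi> Q q v0 \<longrightarrow>
               (\<forall>t\<ge>0. norm (\<psi> t q v0 - \<psi> t q w)
                  \<le> R (C_inv (Q q) (Em q)) (1 / (1 - \<kappa>)) L * infdist v0 M
                    * exp (- rate_integral \<theta> \<beta>0 t q))))"
proof -
  interpret normed_space_over scE by fact
  note family = assms(6)[unfolded quadratic_family_def]
  have sym: "symmetric_operator scE (Q q)" and dim: "subspace_of_dim scE j (Em q)" for q
    by (rule family[THEN conjunct1, THEN spec, THEN conjunct1])
      (rule family[THEN conjunct1, THEN spec, THEN conjunct2, THEN conjunct1])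
  from family[THEN conjunct2] obtain K0 where K0: "\<And>q. norm (Q q) \<le> K0"
    unfolding bdd_above_def by blast
  from assms(12) obtain p0 where p0: "\<And>q. norm (projector (Q q) (Em q)) \<le> p0"
    unfolding bounded_projectors_def bdd_above_def by blast
  obtain n e where frames: "\<forall>q. split_frame (rform (Q q)) (e q) n \<and> Real_Vector_Spaces.span (e q ` {..<n}) = Em q"
    using quadratic_family_frames[OF assms(1,6)] by blast
  interpret squeezed_semicocycle \<theta> \<psi> Q Em \<iota> \<alpha>0 \<beta>0 \<delta> \<tau> e n "\<bar>K0\<bar> + 1" "\<bar>p0\<bar>"
  proof (rule squeezed_semicocycle.intro)
    show "bounded_linear \<iota>" using assms(3) by (simp add: continuous_embedding_def)
    show frame: "split_frame (rform (Q q)) (e q) n"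
      and span: "Real_Vector_Spaces.span (e q ` {..<n}) = Em q" for q
      using frames by auto
    show "blinfun_apply (projector (Q q) (Em q)) = negative_frame.prj (rform (Q q)) (e q) n" for q
    proof (rule projector_eq_prj[OF assms(1) sym _ split_frame.axioms(1)[OF frame] span])
      show "subspace (Em q)"
        using dim[of q] unfolding subspace_of_dim_def by (metis subspace_span)
    qed
    show "\<bar>rform (Q q) v w\<bar> \<le> (\<bar>K0\<bar> + 1) * norm v * norm w" for q v w
    proof -
      have "\<bar>rform (Q q) v w\<bar> \<le> norm (Q q) * norm v * norm w" by (rule rform_bound[OF sym])
      also have "\<dots> \<le> (\<bar>K0\<bar> + 1) * norm v * norm w"
        using K0[of q] by (intro mult_right_mono) auto
      finally show ?thesis .
    qed
    show "norm (projector (Q q) (Em q)) \<le> \<bar>p0\<bar>" for q using p0[of q] by simp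
  qed (use assms in simp_all)
  show ?thesis
  proof (intro conjI allI impI decay_estimate)
    fix q M \<kappa> v0
    assume adm: "0 < \<kappa> \<and> \<kappa> < 1 \<and> admissible \<kappa> (Q q) (Em q) M"
    show ex: "\<exists>w. w \<in> M \<and> w \<in> positive_class \<theta> \<psi> Q q v0"
      using admissible_meets_class adm by blast
    assume "rates_compatible \<theta> \<alpha>0 \<beta>0 q"
    then show "\<exists>!w. w \<in> M \<and> w \<in> positive_class \<theta> \<psi> Q q v0"
      using ex admissible_class_unique adm by blast
  qed
qed

end
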